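(* Let $F(z)=\sum_{k=0}^\infty b_k z^k\in\mathcal{B}$ with $b_1=a\in(0,1)$, where $a=\frac{3\sqrt3}{2}x(1-x^2)$ with $x\in(0,1/\sqrt3)$. Let $r$ satisfy \[ 0<r\le \frac{\sqrt{1/3}-x}{1-x\sqrt{1/3}}. \] Then \[ \sum_{k=1}^\infty k^2|b_k|^2 r^{2k}\le \frac{27 r^2(1-x^2)^2\big((r^2+x^2)(1-r^2x^2)^2-6r^2x^2(1-x^2)(1-r^2)\big)}{4(1-r^2x^2)^5} \] and \[ \sum_{k=1}^\infty k|b_k|^2 r^{2k}\le \frac{27 r^2(1-x^2)^2\big(3x^2(1-r^2)^2+(1-x^2r^2)(r^2-x^2)\big)}{8(1-r^2x^2)^4}. \]
   Context: $\mathbb{D}$ denotes the open unit disc. $\mathcal{B}$ is the class of functions $F$ analytic in $\mathbb{D}$ satisfying $|F'(z)|\le \frac{1}{1-|z|^2}$ for all $z\in\mathbb{D}$. For $F\in\mathcal{B}$ we write its Taylor expansion as $F(z)=\sum_{k=0}^\infty b_k z^k$. *)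

theory Defs
  imports "HOL-Complex_Analysis.Complex_Analysis"
begin

definition bloch_class :: "(complex \<Rightarrow> complex) set" where
  "bloch_class = {F. F holomorphic_on ball 0 1 \<and>
      (\<forall>z\<in>ball 0 1. norm (deriv F z) \<le> 1 / (1 - (norm z)\<^sup>2))}"

definition taylor_coeff :: "(complex \<Rightarrow> complex) \<Rightarrow> nat \<Rightarrow> complex" where
  "taylor_coeff F k = (deriv ^^ k) F 0 / of_nat (fact k)"

end

theory Submission
  imports Defs
begin

text \<open>
  Write \<open>f = F'\<close> and let \<open>G = extremal_deriv x\<close> be the derivative of the extremal Bloch function.
  In the coordinate \<open>w = (z + x) / (1 + x z)\<close> on the disc \<open>\<bar>w\<bar> < 1 / sqrt 3\<close>, the Bloch condition turns
  \<open>f\<close> into a self-map of that disc fixing \<open>x\<close>, while \<open>G\<close> becomes the identity. Schwarz-Pick then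
  puts \<open>f z\<close> into a disc whose boundary touches the curve \<open>G (\<bar>\<zeta>\<bar> = \<bar>z\<bar>)\<close> at \<open>G z\<close> from outside.
  As the class is invariant under rotations, \<open>f z\<close> lies on the inner side of every tangent of that
  curve as long as \<open>\<bar>z\<bar>\<close> is at most the bound assumed for \<open>r\<close>; a nearest-point argument
  gives \<open>f z \<in> G (cball 0 \<bar>z\<bar>)\<close>. Since \<open>G\<close> is injective there, \<open>f = G \<circ> \<omega>\<close> with \<open>\<bar>\<omega> z\<bar> \<le> \<bar>z\<bar>\<close>, and
  Rogosinski's inequality compares the mean squares of \<open>f\<close> and \<open>G\<close>, which is the first estimate.
  The second one is its integral with respect to \<open>r\<^sup>2\<close>.
\<close>

section \<open>Mean squares on circles\<close>

text \<open>\<open>circlepath\<close> is parametrised over the unit interval, so this integral is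
  already the normalised mean, without a factor 1 / (2 pi).\<close>

definition circle_mean_sq :: "real \<Rightarrow> (complex \<Rightarrow> complex) \<Rightarrow> real" where
  "circle_mean_sq r h = integral {0..1} (\<lambda>t. (norm (h (circlepath 0 r t)))\<^sup>2)"

lemma norm_circlepath_0: "0 \<le> r \<Longrightarrow> norm (circlepath 0 r t) = r"
  by (simp add: circlepath norm_mult)

lemma continuous_on_circlepath: "continuous_on S (circlepath z r)"
  unfolding circlepath by (intro continuous_intros)

lemma continuous_on_compose_circlepath:
  assumes "continuous_on (ball 0 s) h" "0 \<le> r" "r < s"
  shows "continuous_on S (\<lambda>t. h (circlepath 0 r t))"
  by (rule continuous_on_compose2[OF assms(1) continuous_on_circlepath])
     (use assms in \<open>auto simp: norm_circlepath_0\<close>)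

lemma circle_mean_sq_integrable:
  assumes "continuous_on (ball 0 s) h" "0 \<le> r" "r < s"
  shows "(\<lambda>t. (norm (h (circlepath 0 r t)))\<^sup>2) integrable_on {0..1}"
  by (intro integrable_continuous_real continuous_intros
        continuous_on_compose_circlepath[OF assms])

lemma circle_mean_sq_mono:
  assumes "continuous_on (ball 0 s) h" "continuous_on (ball 0 s) g" "0 \<le> r" "r < s"
    and "\<And>z. norm z = r \<Longrightarrow> norm (h z) \<le> norm (g z)"
  shows "circle_mean_sq r h \<le> circle_mean_sq r g"
  unfolding circle_mean_sq_def
  by (rule integral_le)
     (use assms in \<open>auto intro!: circle_mean_sq_integrable power_mono simp: norm_circlepath_0\<close>)

lemma circle_mean_sq_cong:
  assumes "\<And>z. norm z = r \<Longrightarrow> h z = g z" "0 \<le> r"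
  shows "circle_mean_sq r h = circle_mean_sq r g"
  unfolding circle_mean_sq_def using assms
  by (intro integral_cong) (auto simp: norm_circlepath_0)

text \<open>A non-integrable integrand has integral 0 by convention, so every \<open>h\<close> is
  covered.\<close>

lemma circle_mean_sq_nonneg: "0 \<le> circle_mean_sq r h"
  unfolding circle_mean_sq_def
  by (metis (no_types, lifting) Henstock_Kurzweil_Integration.integral_nonneg not_integrable_integral
      order_refl zero_le_power2)

lemma circle_mean_sq_mult_id:
  assumes "0 \<le> r"
  shows "circle_mean_sq r (\<lambda>z. z * h z) = r\<^sup>2 * circle_mean_sq r h"
  unfolding circle_mean_sq_def using assms
  by (simp add: norm_mult norm_circlepath_0 power_mult_distrib)

lemma circle_mean_sq_le_const:
  assumes "continuous_on (ball 0 s) h" "0 \<le> r" "r < s" "\<And>z. norm z = r \<Longrightarrow> norm (h z) \<le> B"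
  shows "circle_mean_sq r h \<le> B\<^sup>2"
proof -
  have "circle_mean_sq r h \<le> integral {0..1} (\<lambda>t::real. B\<^sup>2)"
    unfolding circle_mean_sq_def
    by (rule integral_le)
      (use assms in \<open>auto intro!: circle_mean_sq_integrable power_mono simp: norm_circlepath_0\<close>)
  then show ?thesis by simp
qed

text \<open>Mean value property: in Cauchy's formula at the centre, the derivative of the path
  cancels the denominator up to the constant 2 pi i.\<close>

lemma has_integral_circle_mean:
  assumes "h holomorphic_on ball 0 s" "0 < r" "r < s"
  shows "((\<lambda>t. h (circlepath 0 r t)) has_integral h 0) {0..1}"
proof -
  have "h holomorphic_on cball 0 r"
    using assms by (auto intro: holomorphic_on_subset)
  then have "((\<lambda>u. h u / (u - 0)) has_contour_integral (2 * of_real pi * \<i> * h 0)) (circlepath 0 r)"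
    by (rule Cauchy_integral_circlepath_simple) (use assms in auto)
  then have "((\<lambda>t. h (circlepath 0 r t) / circlepath 0 r t *
      vector_derivative (circlepath 0 r) (at t within {0..1})) has_integral 2 * of_real pi * \<i> * h 0) {0..1}"
    by (simp only: has_contour_integral_def diff_zero)
  then have "((\<lambda>t. (2 * of_real pi * \<i>) * h (circlepath 0 r t)) has_integral 2 * of_real pi * \<i> * h 0) {0..1}"
    by (rule has_integral_eq[rotated])
       (use assms in \<open>auto simp: vector_derivative_circlepath01, auto simp: circlepath field_simps\<close>)
  then have "((\<lambda>t. inverse (2 * of_real pi * \<i>) * ((2 * of_real pi * \<i>) * h (circlepath 0 r t)))
      has_integral inverse (2 * of_real pi * \<i>) * (2 * of_real pi * \<i> * h 0)) {0..1}"
    by (rule has_integral_mult_right)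
  then show ?thesis by (simp add: field_simps)
qed

text \<open>Constants are orthogonal to functions vanishing at 0: the cross term is twice the real
  part of \<open>cnj c\<close> times the mean of \<open>h\<close>, and that mean is
  \<open>h 0\<close>.\<close>

lemma circle_mean_sq_add_const:
  assumes h: "h holomorphic_on ball 0 s" "h 0 = 0" and r: "0 < r" "r < s"
  shows "circle_mean_sq r (\<lambda>z. c + h z) = (norm c)\<^sup>2 + circle_mean_sq r h"
proof -
  have "((\<lambda>t. cnj c * h (circlepath 0 r t)) has_integral cnj c * 0) {0..1}"
    using has_integral_mult_right[OF has_integral_circle_mean[OF h(1) r], of "cnj c"] h(2) by simp
  then have cross: "((\<lambda>t. Re (cnj c * h (circlepath 0 r t))) has_integral 0) {0..1}"
    using has_integral_linear[OF _ bounded_linear_Re, of "\<lambda>t. cnj c * h (circlepath 0 r t)" 0]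
    by (simp add: o_def del: times_complex.sel)
  have "continuous_on (ball 0 s) h"
    using h(1) by (rule holomorphic_on_imp_continuous_on)
  then have sq: "((\<lambda>t. (norm (h (circlepath 0 r t)))\<^sup>2) has_integral circle_mean_sq r h) {0..1}"
    unfolding circle_mean_sq_def
    using r by (intro integrable_integral circle_mean_sq_integrable[of s]) auto
  have const: "((\<lambda>t. (norm c)\<^sup>2) has_integral (norm c)\<^sup>2) {0..1::real}"
    using has_integral_const_real[of "(norm c)\<^sup>2" 0 1] by simp
  have "((\<lambda>t. (norm c)\<^sup>2 + 2 * Re (cnj c * h (circlepath 0 r t)) + (norm (h (circlepath 0 r t)))\<^sup>2)
      has_integral (norm c)\<^sup>2 + 2 * 0 + circle_mean_sq r h) {0..1}"
    by (rule has_integral_add[OF has_integral_add[OF const has_integral_mult_right[OF cross]] sq])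
  moreover have "(norm (c + w))\<^sup>2 = (norm c)\<^sup>2 + 2 * Re (cnj c * w) + (norm w)\<^sup>2" for w
    unfolding cmod_power2 by (simp add: power2_eq_square algebra_simps)
  ultimately have "((\<lambda>t. (norm (c + h (circlepath 0 r t)))\<^sup>2)
      has_integral (norm c)\<^sup>2 + circle_mean_sq r h) {0..1}"
    by simp
  then show ?thesis
    unfolding circle_mean_sq_def[of r "\<lambda>z. c + h z"] by (rule integral_unique)
qed

section \<open>Peeling off power series coefficients: Bessel and Rogosinski\<close>

text \<open>The \<open>n\<close>-fold backward shift of the series: what remains after removing the
  first \<open>n\<close> terms and dividing by \<open>w ^ n\<close>.\<close>

definition powser_tail :: "(nat \<Rightarrow> complex) \<Rightarrow> nat \<Rightarrow> complex \<Rightarrow> complex" where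
  "powser_tail A n w = (\<Sum>k. A (k + n) * w ^ k)"

lemma summable_powser_tail:
  fixes A :: "nat \<Rightarrow> complex"
  assumes "\<forall>w::complex. norm w < s \<longrightarrow> summable (\<lambda>k. A k * w ^ k)" "norm w < s"
  shows "summable (\<lambda>k. A (k + n) * w ^ k)"
proof (cases "w = 0")
  case True
  then show ?thesis using summable_0_powser[of "\<lambda>k. A (k + n)"] by simp
next
  case False
  have "summable (\<lambda>k. A (k + n) * w ^ (k + n))"
    using assms summable_ignore_initial_segment[of "\<lambda>k. A k * w ^ k" n] by auto
  then have "summable (\<lambda>k. (A (k + n) * w ^ (k + n)) * inverse (w ^ n))"
    by (rule summable_mult2)
  then show ?thesis using False by (simp add: power_add mult.assoc)
qed

lemma powser_tail_holomorphic:
  fixes A :: "nat \<Rightarrow> complex"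
  assumes "\<forall>w::complex. norm w < s \<longrightarrow> summable (\<lambda>k. A k * w ^ k)"
  shows "powser_tail A n holomorphic_on ball 0 s"
proof (rule power_series_holomorphic[where a = "\<lambda>k. A (k + n)"])
  fix w :: complex assume "w \<in> ball 0 s"
  then show "(\<lambda>k. A (k + n) * (w - 0) ^ k) sums powser_tail A n w"
    unfolding powser_tail_def using summable_powser_tail[OF assms, of w n]
    by (simp add: summable_sums)
qed

lemma powser_tail_Suc:
  fixes A :: "nat \<Rightarrow> complex"
  assumes "\<forall>w::complex. norm w < s \<longrightarrow> summable (\<lambda>k. A k * w ^ k)" "norm w < s"
  shows "powser_tail A n w = A n + w * powser_tail A (Suc n) w"
proof -
  have "powser_tail A n w = A n + (\<Sum>k. A (Suc k + n) * w ^ Suc k)"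
    unfolding powser_tail_def
    using suminf_split_head[OF summable_powser_tail[OF assms, of n]] by simp
  also have "(\<Sum>k. A (Suc k + n) * w ^ Suc k) = (\<Sum>k. w * (A (k + Suc n) * w ^ k))"
    by (simp add: mult_ac)
  also have "\<dots> = w * powser_tail A (Suc n) w"
    unfolding powser_tail_def by (rule suminf_mult[OF summable_powser_tail[OF assms]])
  finally show ?thesis .
qed

text \<open>Everything beyond \<open>A n\<close> carries a factor \<open>\<omega> z\<close>, and
  \<open>\<omega> 0 = 0\<close>, so the constant splits off orthogonally. The identity as
  \<open>\<omega>\<close> leads to Bessel's inequality, a general \<open>\<omega>\<close> to
  Rogosinski's.\<close>

lemma circle_mean_sq_powser_step:
  fixes A :: "nat \<Rightarrow> complex"
  assumes A: "\<forall>w::complex. norm w < s \<longrightarrow> summable (\<lambda>k. A k * w ^ k)"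
    and om: "\<omega> holomorphic_on ball 0 s" "\<And>z. norm z < s \<Longrightarrow> norm (\<omega> z) \<le> norm z"
    and r: "0 < r" "r < s"
  shows "circle_mean_sq r (\<lambda>z. powser_tail A n (\<omega> z)) =
    (norm (A n))\<^sup>2 + circle_mean_sq r (\<lambda>z. \<omega> z * powser_tail A (Suc n) (\<omega> z))"
proof -
  have im: "\<omega> ` ball 0 s \<subseteq> ball 0 s"
    using om(2) by force
  have hol: "(\<lambda>z. \<omega> z * powser_tail A (Suc n) (\<omega> z)) holomorphic_on ball 0 s"
    using holomorphic_on_compose_gen[OF om(1) powser_tail_holomorphic[OF A] im, of "Suc n"] om(1)
    by (auto simp: o_def intro!: holomorphic_intros)
  have "circle_mean_sq r (\<lambda>z. powser_tail A n (\<omega> z)) =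
      circle_mean_sq r (\<lambda>z. A n + \<omega> z * powser_tail A (Suc n) (\<omega> z))"
  proof (rule circle_mean_sq_cong)
    fix z :: complex assume "norm z = r"
    then have "norm (\<omega> z) < s" using om(2)[of z] r by auto
    then show "powser_tail A n (\<omega> z) = A n + \<omega> z * powser_tail A (Suc n) (\<omega> z)"
      by (rule powser_tail_Suc[OF A])
  qed (use r in auto)
  also have "\<dots> = (norm (A n))\<^sup>2 + circle_mean_sq r (\<lambda>z. \<omega> z * powser_tail A (Suc n) (\<omega> z))"
  proof (rule circle_mean_sq_add_const[OF hol _ r])
    show "\<omega> 0 * powser_tail A (Suc n) (\<omega> 0) = 0"
      using om(2)[of 0] r by simp
  qed
  finally show ?thesis .
qed

text \<open>With the identity as \<open>\<omega>\<close>, peeling is an exact equality; the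
  nonnegative mean square of the \<open>N\<close>-th tail is dropped at the end.\<close>

lemma bessel_circle_mean_sq:
  fixes A :: "nat \<Rightarrow> complex"
  assumes f: "\<And>z. norm z < s \<Longrightarrow> (\<lambda>k. A k * z ^ k) sums f z" and r: "0 < r" "r < s"
  shows "(\<Sum>k<N. (norm (A k))\<^sup>2 * r ^ (2 * k)) \<le> circle_mean_sq r f"
proof -
  have A: "\<forall>w::complex. norm w < s \<longrightarrow> summable (\<lambda>k. A k * w ^ k)"
    using f sums_summable by blast
  have step: "circle_mean_sq r (powser_tail A n) =
      (norm (A n))\<^sup>2 + r\<^sup>2 * circle_mean_sq r (powser_tail A (Suc n))" for n
    using circle_mean_sq_powser_step[OF A, of "\<lambda>z. z" r n] r
    by (simp add: circle_mean_sq_mult_id eta_contract_eq)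
  have "circle_mean_sq r (powser_tail A 0) =
     (\<Sum>k<N. (norm (A k))\<^sup>2 * r ^ (2 * k)) + r ^ (2 * N) * circle_mean_sq r (powser_tail A N)"
  proof (induction N)
    case (Suc N)
    then show ?case
      unfolding step[of N] by (simp add: algebra_simps power2_eq_square)
  qed simp
  moreover have "circle_mean_sq r (powser_tail A 0) = circle_mean_sq r f"
    using f r by (intro circle_mean_sq_cong) (auto simp: powser_tail_def sums_iff)
  ultimately show ?thesis
    using circle_mean_sq_nonneg[of r "powser_tail A N"] r by simp
qed

text \<open>Rogosinski's inequality: peeling off one coefficient of the outer function at a time, the
  factor \<open>\<omega>\<close> that appears costs at most \<open>r\<^sup>2\<close> in the mean square.\<close>

lemma rogosinski_circle_mean_sq:
  fixes A :: "nat \<Rightarrow> complex"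
  assumes f: "\<And>z. norm z < s \<Longrightarrow> (\<lambda>k. A k * \<omega> z ^ k) sums f z"
    and A: "\<forall>w::complex. norm w < s \<longrightarrow> summable (\<lambda>k. A k * w ^ k)"
    and om: "\<omega> holomorphic_on ball 0 s" "\<And>z. norm z < s \<Longrightarrow> norm (\<omega> z) \<le> norm z"
    and r: "0 < r" "r < s"
    and S: "(\<lambda>k. (norm (A k))\<^sup>2 * r ^ (2 * k)) sums S"
  shows "circle_mean_sq r f \<le> S"
proof -
  have im: "\<omega> ` ball 0 s \<subseteq> ball 0 s"
    using om(2) by force
  have cont: "continuous_on (ball 0 s) (\<lambda>z. powser_tail A n (\<omega> z))" for n
    using holomorphic_on_compose_gen[OF om(1) powser_tail_holomorphic[OF A] im, of n]
    by (auto simp: o_def intro: holomorphic_on_imp_continuous_on)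
  have contom: "continuous_on (ball 0 s) \<omega>"
    using om(1) by (rule holomorphic_on_imp_continuous_on)
  have step: "circle_mean_sq r (\<lambda>z. powser_tail A n (\<omega> z)) \<le>
      (norm (A n))\<^sup>2 + r\<^sup>2 * circle_mean_sq r (\<lambda>z. powser_tail A (Suc n) (\<omega> z))" for n
  proof -
    have "circle_mean_sq r (\<lambda>z. \<omega> z * powser_tail A (Suc n) (\<omega> z)) \<le>
        circle_mean_sq r (\<lambda>z. z * powser_tail A (Suc n) (\<omega> z))"
      using r om(2)
      by (intro circle_mean_sq_mono[where s = s] continuous_intros cont contom)
         (auto simp: norm_mult intro!: mult_right_mono)
    then show ?thesis
      using circle_mean_sq_powser_step[OF A om r, of n] r by (simp add: circle_mean_sq_mult_id)
  qed
  have bound: "circle_mean_sq r (\<lambda>z. powser_tail A 0 (\<omega> z)) \<le>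
     (\<Sum>k<N. (norm (A k))\<^sup>2 * r ^ (2 * k)) + r ^ (2 * N) * circle_mean_sq r (\<lambda>z. powser_tail A N (\<omega> z))" for N
  proof (induction N)
    case (Suc N)
    have "r ^ (2 * N) * circle_mean_sq r (\<lambda>z. powser_tail A N (\<omega> z)) \<le>
        r ^ (2 * N) * ((norm (A N))\<^sup>2 + r\<^sup>2 * circle_mean_sq r (\<lambda>z. powser_tail A (Suc N) (\<omega> z)))"
      using r by (intro mult_left_mono step) auto
    with Suc show ?case by (simp add: algebra_simps power2_eq_square)
  qed simp
  \<comment> \<open>Convergence at a slightly larger radius gives absolute convergence at
    \<open>r\<close>.\<close>
  obtain r' where r': "r < r'" "r' < s" using dense r by blast
  have "summable (\<lambda>k. A k * of_real r' ^ k)"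
    using r' r A by auto
  then have sn: "summable (\<lambda>k. norm (A k) * r ^ k)"
    using powser_insidea[of A "of_real r'" "of_real r :: complex"] r r' by (simp add: norm_mult norm_power)
  define t where "t N = (\<Sum>k. norm (A (k + N)) * r ^ (k + N))" for N
  have t_lim: "t \<longlonglongrightarrow> 0"
    unfolding t_def using suminf_exist_split2[OF sn] .
  \<comment> \<open>Since \<open>norm (\<omega> z) \<le> r\<close> on the circle, \<open>t N\<close>
    dominates \<open>r ^ N\<close> times the tail there. The leftover term in \<open>bound\<close>
    therefore vanishes in the limit.\<close>
  have tail: "r ^ (2 * N) * circle_mean_sq r (\<lambda>z. powser_tail A N (\<omega> z)) \<le> (t N)\<^sup>2" for N
  proof -
    have sN: "summable (\<lambda>k. norm (A (k + N)) * r ^ (k + N))"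
      using summable_ignore_initial_segment[OF sn, of N] .
    then have "summable (\<lambda>k. inverse (r ^ N) * (norm (A (k + N)) * r ^ (k + N)))"
      by (rule summable_mult)
    then have sN': "summable (\<lambda>k. norm (A (k + N)) * r ^ k)"
      using r by (simp add: power_add field_simps)
    have tN: "t N = r ^ N * (\<Sum>k. norm (A (k + N)) * r ^ k)"
      unfolding t_def using suminf_mult[OF sN', of "r ^ N"] by (simp add: power_add mult_ac)
    have "norm (powser_tail A N (\<omega> z)) \<le> (\<Sum>k. norm (A (k + N)) * r ^ k)" if "norm z = r" for z
      unfolding powser_tail_def
    proof (rule norm_suminf_le[OF _ sN'])
      fix k
      show "norm (A (k + N) * \<omega> z ^ k) \<le> norm (A (k + N)) * r ^ k"
        using om(2)[of z] that r by (auto simp: norm_mult norm_power intro!: mult_left_mono power_mono)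
    qed
    then have "circle_mean_sq r (\<lambda>z. powser_tail A N (\<omega> z)) \<le> (\<Sum>k. norm (A (k + N)) * r ^ k)\<^sup>2"
      using circle_mean_sq_le_const[OF cont, of r N] r by auto
    then have "r ^ (2 * N) * circle_mean_sq r (\<lambda>z. powser_tail A N (\<omega> z)) \<le>
        r ^ (2 * N) * (\<Sum>k. norm (A (k + N)) * r ^ k)\<^sup>2"
      using r by (intro mult_left_mono) auto
    then show ?thesis unfolding tN by (simp add: power_mult_distrib power_mult mult.commute[of 2])
  qed
  have "(\<lambda>N. (\<Sum>k<N. (norm (A k))\<^sup>2 * r ^ (2 * k)) + (t N)\<^sup>2) \<longlonglongrightarrow> S + 0\<^sup>2"
    using S t_lim unfolding sums_def by (intro tendsto_intros)
  moreover have "circle_mean_sq r (\<lambda>z. powser_tail A 0 (\<omega> z)) \<le>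
      (\<Sum>k<N. (norm (A k))\<^sup>2 * r ^ (2 * k)) + (t N)\<^sup>2" for N
    using bound[of N] tail[of N] by linarith
  ultimately have "circle_mean_sq r (\<lambda>z. powser_tail A 0 (\<omega> z)) \<le> S + 0\<^sup>2"
    by (intro LIMSEQ_le_const) auto
  moreover have "circle_mean_sq r (\<lambda>z. powser_tail A 0 (\<omega> z)) = circle_mean_sq r f"
    using f r by (intro circle_mean_sq_cong) (auto simp: powser_tail_def sums_iff)
  ultimately show ?thesis by simp
qed

section \<open>Schwarz-Pick and subordination\<close>

text \<open>Conjugating \<open>K\<close> by the Moebius map that sends \<open>p\<close> to 0 reduces
  the claim to the Schwarz lemma. The inequality is cross-multiplied to avoid quotients.\<close>

lemma schwarz_pick_fixed_point:
  assumes K: "K holomorphic_on ball 0 1" "\<And>u. norm u < 1 \<Longrightarrow> norm (K u) \<le> 1"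
    and p: "norm p < 1" "K p = p" and u: "norm u < 1"
  shows "norm (K u - p) * norm (1 - cnj p * u) \<le> norm (u - p) * norm (1 - cnj p * K u)"
proof -
  \<comment> \<open>Modulus 1 at an interior point would make \<open>K\<close> constant by the
    maximum principle, although its value at \<open>p\<close> has modulus less than 1.\<close>
  have K1: "norm (K v) < 1" if v: "norm v < 1" for v
  proof (rule ccontr)
    assume "\<not> norm (K v) < 1"
    then have nv: "norm (K v) = 1" using K(2)[OF v] by simp
    have "K constant_on ball 0 1"
      by (rule maximum_modulus_principle[OF K(1), of "ball 0 1" v]) (use v nv K(2) in auto)
    then have "K p = K v" using p v by (auto simp: constant_on_def)
    with p nv show False by simp
  qed
  define \<Phi> where "\<Phi> = Moebius_function 0 p \<circ> K \<circ> Moebius_function 0 (-p)"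
  have m: "norm (Moebius_function 0 (-p) v) < 1" if "norm v < 1" for v
    using Moebius_function_norm_lt_1[of "-p" v 0] p that by simp
  have hol: "\<Phi> holomorphic_on ball 0 1"
    unfolding \<Phi>_def
  proof (intro holomorphic_on_compose_gen[where t = "ball 0 1"] Moebius_function_holomorphic K(1))
    show "Moebius_function 0 (-p) ` ball 0 1 \<subseteq> ball 0 1" "K ` ball 0 1 \<subseteq> ball 0 1"
      using m K1 by auto
  qed (use p m K1 in auto)
  have 0: "\<Phi> 0 = 0"
    using p by (simp add: \<Phi>_def Moebius_function_of_zero Moebius_function_eq_zero)
  have lt: "norm (\<Phi> v) < 1" if "norm v < 1" for v
    unfolding \<Phi>_def o_def using p that m K1 by (intro Moebius_function_norm_lt_1) auto
  have "norm (Moebius_function 0 p u) < 1"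
    using p u by (intro Moebius_function_norm_lt_1)
  then have "norm (\<Phi> (Moebius_function 0 p u)) \<le> norm (Moebius_function 0 p u)"
    using Schwarz_Lemma(1)[OF hol 0 lt] by blast
  also have "\<Phi> (Moebius_function 0 p u) = Moebius_function 0 p (K u)"
    unfolding \<Phi>_def using Moebius_function_compose[of "-p" p u] p u by simp
  finally have le: "norm ((K u - p) / (1 - cnj p * K u)) \<le> norm ((u - p) / (1 - cnj p * u))"
    by (simp add: Moebius_function_simple)
  have nz: "norm (1 - cnj p * v) > 0" if "norm v < 1" for v
  proof -
    have "norm (cnj p * v) < 1"
      using norm_mult_less[of "cnj p" 1 v 1] p that by simp
    then show ?thesis by auto
  qed
  show ?thesis
    using le nz[OF u] nz[OF K1[OF u]] by (simp add: norm_divide field_simps)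
qed

text \<open>The hyperbolic disc about \<open>p\<close> through \<open>u\<close> is a Euclidean disc with outer normal
  \<open>(u - p)(1 - p u)\<close> at \<open>u\<close>.\<close>

lemma schwarz_pick_fixed_point_halfplane:
  fixes p :: real
  assumes K: "K holomorphic_on ball 0 1" "\<And>u. norm u < 1 \<Longrightarrow> norm (K u) \<le> 1"
    and p: "\<bar>p\<bar> < 1" "K (of_real p) = of_real p" and u: "norm u < 1"
  shows "Re ((K u - u) * cnj ((u - of_real p) * (1 - of_real p * u))) \<le> 0"
proof -
  define P where "P = complex_of_real p"
  define d where "d = K u - u"
  have "norm (K u - P) * norm (1 - P * u) \<le> norm (u - P) * norm (1 - P * K u)"
    using schwarz_pick_fixed_point[OF K, of P u] p u by (simp add: P_def)
  then have "(norm (K u - P) * norm (1 - P * u))\<^sup>2 \<le> (norm (u - P) * norm (1 - P * K u))\<^sup>2"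
    by (intro power_mono) auto
  then have sq: "(norm (u - P + d))\<^sup>2 * (norm (1 - P * u))\<^sup>2 \<le> (norm (u - P))\<^sup>2 * (norm (1 - P * u - P * d))\<^sup>2"
    by (simp add: d_def power_mult_distrib algebra_simps)
  \<comment> \<open>Expansion in \<open>d\<close>: the linear term is the quantity to be bounded,
    and the quadratic term is nonnegative by \<open>id2\<close>, because
    \<open>1 + p\<^sup>2 - 2 * p * Re u\<close> is at least (1 - |p|)^2.\<close>
  have id: "(norm (u - P + d))\<^sup>2 * (norm (1 - P * u))\<^sup>2 - (norm (u - P))\<^sup>2 * (norm (1 - P * u - P * d))\<^sup>2
     = 2 * (1 - p\<^sup>2) * Re (d * cnj ((u - P) * (1 - P * u)))
       + (norm d)\<^sup>2 * ((norm (1 - P * u))\<^sup>2 - p\<^sup>2 * (norm (u - P))\<^sup>2)"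
    unfolding P_def cmod_power2 by (simp add: power2_eq_square) algebra
  have id2: "(norm (1 - P * u))\<^sup>2 - p\<^sup>2 * (norm (u - P))\<^sup>2 = (1 - p\<^sup>2) * (1 + p\<^sup>2 - 2 * p * Re u)"
    unfolding P_def cmod_power2 by (simp add: power2_eq_square) algebra
  have p2: "p\<^sup>2 < 1" using p by (simp add: abs_square_less_1)
  have "2 * p * Re u \<le> 1 + p\<^sup>2"
  proof -
    have "\<bar>p * Re u\<bar> \<le> \<bar>p\<bar> * 1"
      unfolding abs_mult using u abs_Re_le_cmod[of u] by (intro mult_left_mono) auto
    moreover have "2 * \<bar>p\<bar> \<le> 1 + p\<^sup>2"
      using zero_le_power2[of "1 - \<bar>p\<bar>"] by (simp add: power2_eq_square algebra_simps)
    ultimately show ?thesis by linarith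
  qed
  then have "0 \<le> (norm d)\<^sup>2 * ((norm (1 - P * u))\<^sup>2 - p\<^sup>2 * (norm (u - P))\<^sup>2)"
    unfolding id2 using p2 by (intro mult_nonneg_nonneg) auto
  then have "2 * (1 - p\<^sup>2) * Re (d * cnj ((u - P) * (1 - P * u))) \<le> 0"
    using id sq by linarith
  then show ?thesis
    using p2 unfolding d_def P_def by (simp add: mult_le_0_iff)
qed

section \<open>Subordination from a nearest-point argument\<close>

text \<open>The vector \<open>z * G' z\<close> is the outer normal of the image curve at
  \<open>G z\<close>. If \<open>q\<close> were outside the image, the point of the image nearest to
  \<open>q\<close> could be moved closer to \<open>q\<close> without leaving the image: freely at an
  interior point, and by the normal condition at a boundary point.\<close>

lemma mem_image_cball_of_normal_condition:
  fixes G :: "complex \<Rightarrow> complex"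
  assumes G: "\<And>z. norm z \<le> s \<Longrightarrow> (G has_field_derivative G' z) (at z)"
    and nz: "\<And>z. norm z \<le> s \<Longrightarrow> G' z \<noteq> 0" and s: "0 < s"
    and q: "\<And>z. norm z = s \<Longrightarrow> Re ((q - G z) * cnj (z * G' z)) \<le> 0"
  shows "q \<in> G ` cball 0 s"
proof (rule ccontr)
  assume "q \<notin> G ` cball 0 s"
  have "continuous_on (cball 0 s) G"
    by (rule DERIV_continuous_on, rule has_field_derivative_at_within, rule G) auto
  then have "continuous_on (cball 0 s) (\<lambda>z. norm (q - G z))"
    by (intro continuous_intros)
  then obtain b where b: "norm b \<le> s" and min: "\<And>z. norm z \<le> s \<Longrightarrow> norm (q - G b) \<le> norm (q - G z)"
    using continuous_attains_inf[of "cball 0 s" "\<lambda>z. norm (q - G z)"] s by auto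
  define n where "n = q - G b"
  have "n \<noteq> 0" using \<open>q \<notin> _\<close> b by (auto simp: n_def)
  define N where "N = b * G' b"
  have qb: "Re (n * cnj N) \<le> 0" if "norm b = s"
    using q[OF that] unfolding n_def N_def .
  \<comment> \<open>Moving \<open>G b\<close> in the direction \<open>m\<close> stays in the image of the disc and approaches \<open>q\<close>.\<close>
  define m where "m = (if norm b = s then n - N else n)"
  define v where "v = m / G' b"
  have sq: "Re (z * cnj z) = (norm z)\<^sup>2" for z
    unfolding cmod_power2 by (simp add: power2_eq_square)
  have m1: "Re (m * cnj n) > 0"
  proof -
    have "Re (n * cnj n) > 0"
      unfolding sq using \<open>n \<noteq> 0\<close> by simp
    moreover have "Re (N * cnj n) = Re (n * cnj N)"
      by (simp add: algebra_simps)
    ultimately show ?thesis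
      using qb by (auto simp: m_def left_diff_distrib simp del: times_complex.sel)
  qed
  \<comment> \<open>\<open>v\<close> is \<open>m\<close> pulled back to the domain, and
    \<open>v * cnj b\<close> is a positive multiple of \<open>m * cnj N\<close>. So \<open>v\<close>
    points strictly into the disc; the summand \<open>- N\<close> of \<open>m\<close> gives
    strictness even when \<open>Re (n * cnj N) = 0\<close>.\<close>
  have m2: "Re (v * cnj b) < 0" if "norm b = s"
  proof -
    have "N \<noteq> 0" using nz[OF b] that s by (auto simp: N_def)
    then have "Re (N * cnj N) > 0"
      unfolding sq by simp
    then have "Re (m * cnj N) < 0"
      using qb[OF that] that by (simp add: m_def left_diff_distrib del: times_complex.sel)
    moreover have "v * cnj b = m * cnj N / of_real ((norm (G' b))\<^sup>2)"
      unfolding v_def N_def using nz[OF b] by (simp add: complex_norm_square field_simps del: of_real_power)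
    ultimately show ?thesis
      using nz[OF b] by (simp add: divide_less_0_iff Re_divide_of_real del: of_real_power times_complex.sel)
  qed
  have "((\<lambda>t::real. (norm (b + of_real t * v))\<^sup>2) has_real_derivative 2 * Re (v * cnj b)) (at 0)"
    unfolding cmod_power2 by (auto intro!: derivative_eq_intros simp: algebra_simps)
  then have d1: "\<exists>e>0. \<forall>t>0. t < e \<longrightarrow> norm (b + of_real t * v) \<le> s"
  proof (cases "norm b = s")
    case True
    then obtain e where e: "e > 0" "\<And>t. 0 < t \<Longrightarrow> t < e \<Longrightarrow> (norm (b + of_real (0 + t) * v))\<^sup>2 < (norm (b + of_real 0 * v))\<^sup>2"
      using DERIV_neg_dec_right[OF \<open>(_ has_real_derivative _) (at 0)\<close>] m2 by auto
    have "norm (b + of_real t * v) \<le> s" if "0 < t" "t < e" for t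
      using e(2)[OF that] True s by (simp add: power_less_imp_less_base less_imp_le)
    with e(1) show ?thesis by blast
  next
    case False
    then have "norm b < s" using b by simp
    moreover have "(\<lambda>t::real. norm (b + of_real t * v)) \<midarrow>0\<rightarrow> norm (b + of_real 0 * v)"
      by (intro tendsto_intros)
    ultimately have "eventually (\<lambda>t::real. norm (b + of_real t * v) < s) (at 0)"
      by (intro order_tendstoD(2)) auto
    then obtain e where "e > 0" "\<And>t. t \<noteq> 0 \<Longrightarrow> dist t 0 < e \<Longrightarrow> norm (b + of_real t * v) < s"
      unfolding eventually_at by auto
    then show ?thesis by (intro exI[of _ e]) (force intro: less_imp_le)
  qed
  then obtain e1 where e1: "e1 > 0" "\<And>t. 0 < t \<Longrightarrow> t < e1 \<Longrightarrow> norm (b + of_real t * v) \<le> s"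
    by blast
  \<comment> \<open>The squared length of \<open>\<gamma>\<close> has slope
    \<open>- (2 * Re (m * cnj n))\<close> at 0, which is negative by \<open>m1\<close>; this
    contradicts the minimality of \<open>b\<close>.\<close>
  define \<gamma> where "\<gamma> t = q - G (b + of_real t * v)" for t :: real
  have "((\<lambda>t::real. b + of_real t * v) has_vector_derivative v) (at 0)"
    by (auto intro!: derivative_eq_intros simp: has_vector_derivative_def scaleR_conv_of_real)
  then have "((\<lambda>t::real. G (b + of_real t * v)) has_vector_derivative v * G' b) (at 0)"
    using field_vector_diff_chain_at[of "\<lambda>t::real. b + of_real t * v" v 0 G "G' b"] G[OF b]
    by (simp add: o_def)
  then have g: "(\<gamma> has_vector_derivative - m) (at 0)"
    unfolding \<gamma>_def using nz[OF b]
    by (auto intro!: derivative_eq_intros simp: v_def)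
  have "((\<lambda>t. (norm (\<gamma> t))\<^sup>2) has_real_derivative - (2 * Re (m * cnj n))) (at 0)"
  proof -
    have "\<gamma> 0 = n" by (simp add: \<gamma>_def n_def)
    then show ?thesis unfolding cmod_power2
      by (auto intro!: derivative_eq_intros g simp: algebra_simps)
  qed
  then obtain e2 where e2: "e2 > 0" "\<And>t. 0 < t \<Longrightarrow> t < e2 \<Longrightarrow> (norm (\<gamma> (0 + t)))\<^sup>2 < (norm (\<gamma> 0))\<^sup>2"
    using DERIV_neg_dec_right[of "\<lambda>t. (norm (\<gamma> t))\<^sup>2" "- (2 * Re (m * cnj n))" 0] m1 by auto
  define t where "t = min e1 e2 / 2"
  have t: "0 < t" "t < e1" "t < e2" using e1(1) e2(1) by (auto simp: t_def)
  have "norm (\<gamma> t) < norm (\<gamma> 0)"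
    using e2(2)[OF t(1,3)] by (simp add: power_less_imp_less_base)
  moreover have "norm (\<gamma> 0) \<le> norm (\<gamma> t)"
    using min[OF e1(2)[OF t(1,2)]] by (simp add: \<gamma>_def)
  ultimately show False by simp
qed

text \<open>Take \<open>\<omega>\<close> to be the inverse of \<open>G\<close> after
  \<open>f\<close>. Membership in the image of the disc of radius \<open>norm z\<close>, for each
  \<open>z\<close> separately, is what yields the bound on \<open>\<omega> z\<close>.\<close>

lemma subordination_of_mem_image_cball:
  assumes f: "f holomorphic_on ball 0 s" and G: "G holomorphic_on ball 0 s" "inj_on G (ball 0 s)"
    and mem: "\<And>z. norm z < s \<Longrightarrow> f z \<in> G ` cball 0 (norm z)"
  obtains \<omega> where "\<omega> holomorphic_on ball 0 s" "\<And>z. norm z < s \<Longrightarrow> norm (\<omega> z) \<le> norm z"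
    "\<And>z. norm z < s \<Longrightarrow> f z = G (\<omega> z)"
proof -
  obtain H where H: "H holomorphic_on (G ` ball 0 s)" "\<And>z. z \<in> ball 0 s \<Longrightarrow> H (G z) = z"
    using holomorphic_has_inverse[OF G(1) open_ball G(2)] by metis
  have sub: "G ` cball 0 (norm z) \<subseteq> G ` ball 0 s" if "norm z < s" for z :: complex
    using that by (intro image_mono) auto
  have "H \<circ> f holomorphic_on ball 0 s"
    by (rule holomorphic_on_compose_gen[OF f H(1)]) (use mem sub in fastforce)
  moreover have "norm ((H \<circ> f) z) \<le> norm z \<and> f z = G ((H \<circ> f) z)" if z: "norm z < s" for z
  proof -
    obtain v where "norm v \<le> norm z" "f z = G v" using mem[OF z] by auto
    then show ?thesis using H(2)[of v] z by auto
  qed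
  ultimately show ?thesis by (intro that) blast+
qed

section \<open>Coefficients of the extremal function\<close>

text \<open>Induction on \<open>j\<close>: the Cauchy product with the geometric series raises the
  exponent by one, and the coefficients add up by the hockey-stick identity. Rising factorials form
  a basis in which polynomial coefficients can be summed.\<close>

lemma negative_binomial_sums:
  fixes v :: "'a :: {real_normed_field, banach}"
  assumes "norm v < 1"
  shows "(\<lambda>k. pochhammer (of_nat k + 1) j * v ^ k) sums (fact j / (1 - v) ^ Suc j)"
proof -
  have "(\<lambda>k. of_nat ((k + j) choose j) * v ^ k) sums (1 / (1 - v) ^ Suc j)"
    using assms
  proof (induction j arbitrary: v)
    case 0
    then show ?case using geometric_sums[of v] by simp
  next
    case (Suc j)
    obtain d where d: "norm v < d" "d < 1" using dense Suc.prems by blast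
    then have "0 < d" using norm_ge_zero[of v] by linarith
    then have "summable (\<lambda>k. of_nat ((k + j) choose j) * (of_real d :: 'a) ^ k)"
      using Suc.IH[of "of_real d"] d by (auto simp: sums_iff)
    then have 1: "summable (\<lambda>k. norm (of_nat ((k + j) choose j) * v ^ k))"
      using powser_insidea[of "\<lambda>k. of_nat ((k + j) choose j)" "of_real d" v] d \<open>0 < d\<close> by simp
    have 2: "summable (\<lambda>k. norm (v ^ k))"
      using Suc.prems by (simp add: norm_power)
    have "(\<Sum>i\<le>k. of_nat ((i + j) choose j) * v ^ i * v ^ (k - i)) = of_nat ((k + Suc j) choose Suc j) * v ^ k" for k
    proof -
      have "(\<Sum>i\<le>k. of_nat ((i + j) choose j) * v ^ i * v ^ (k - i)) = (\<Sum>i\<le>k. of_nat ((j + i) choose j) * v ^ k)"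
        by (rule sum.cong) (auto simp: mult.assoc add.commute simp flip: power_add)
      also have "\<dots> = of_nat (\<Sum>i\<le>k. (j + i) choose j) * v ^ k"
        by (simp add: sum_distrib_right)
      also have "(\<Sum>i\<le>k. (j + i) choose j) = (k + Suc j) choose Suc j"
        using choose_rising_sum(1)[of j k] by (simp add: add.commute)
      finally show ?thesis .
    qed
    then show ?case
      using Cauchy_product_sums[OF 1 2] Suc.IH[OF Suc.prems] geometric_sums[OF Suc.prems]
      by (simp add: sums_iff mult.commute)
  qed
  then have "(\<lambda>k. fact j * (of_nat ((k + j) choose j) * v ^ k)) sums (fact j * (1 / (1 - v) ^ Suc j))"
    by (rule sums_mult)
  moreover have "fact j * of_nat ((k + j) choose j) = (pochhammer (of_nat k + 1) j :: 'a)" for k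
    by (simp add: binomial_gbinomial gbinomial_pochhammer')
  ultimately show ?thesis by (simp add: mult.assoc[symmetric])
qed

text \<open>The derivative of \<open>3 * sqrt 3 / 4 * ((z + x) / (1 + x * z))\<^sup>2\<close>.\<close>

definition extremal_deriv :: "real \<Rightarrow> complex \<Rightarrow> complex" where
  "extremal_deriv x z = of_real (3 * sqrt 3 / 2 * (1 - x\<^sup>2)) * ((z + of_real x) / (1 + of_real x * z) ^ 3)"

definition extremal_deriv2 :: "real \<Rightarrow> complex \<Rightarrow> complex" where
  "extremal_deriv2 x z = of_real (3 * sqrt 3 / 2 * (1 - x\<^sup>2)) *
     ((1 - 3 * (of_real x)\<^sup>2 - 2 * of_real x * z) / (1 + of_real x * z) ^ 4)"

definition extremal_coeff :: "real \<Rightarrow> nat \<Rightarrow> complex" where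
  "extremal_coeff x k = of_real (3 * sqrt 3 / 2 * (1 - x\<^sup>2) / (2 * x) * (- x) ^ k *
     ((real k + 1) * ((real k + 2) * x\<^sup>2 - real k)))"

lemma extremal_deriv_has_field_derivative:
  assumes "1 + of_real x * z \<noteq> 0"
  shows "(extremal_deriv x has_field_derivative extremal_deriv2 x z) (at z)"
proof -
  have "((\<lambda>z. (z + of_real x) / (1 + of_real x * z) ^ 3) has_field_derivative
      (1 - 3 * (of_real x)\<^sup>2 - 2 * of_real x * z) / (1 + of_real x * z) ^ 4) (at z)"
    using assms
    by (auto intro!: derivative_eq_intros)
       (simp add: divide_simps, simp add: eval_nat_numeral algebra_simps)
  then show ?thesis
    unfolding extremal_deriv_def extremal_deriv2_def by (rule DERIV_cmult)
qed

text \<open>With \<open>v = - (x z)\<close> one has x (z + x) = (x^2 - 1) + (1 - v), so the function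
  splits into multiples of (1 - v)^(-3) and (1 - v)^(-2). Division by \<open>x\<close> explains the
  factor 1 / (2 x) in \<open>extremal_coeff\<close>.\<close>

lemma extremal_coeff_sums:
  assumes "x \<noteq> 0" "norm (of_real x * z) < 1"
  shows "(\<lambda>k. extremal_coeff x k * z ^ k) sums extremal_deriv x z"
proof -
  define v where "v = - (of_real x * z)"
  define c where "c = complex_of_real (3 * sqrt 3 / 2 * (1 - x\<^sup>2))"
  have v: "norm v < 1" using assms by (simp add: v_def)
  have nz: "1 - v \<noteq> 0" using v by auto
  have "(\<lambda>k. c / (2 * of_real x) * (((of_real x)\<^sup>2 - 1) * (pochhammer (of_nat k + 1) 2 * v ^ k)
        + 2 * (pochhammer (of_nat k + 1) 1 * v ^ k)))
     sums (c / (2 * of_real x) * (((of_real x)\<^sup>2 - 1) * (fact 2 / (1 - v) ^ Suc 2)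
        + 2 * (fact 1 / (1 - v) ^ Suc 1)))"
    by (intro sums_mult sums_add negative_binomial_sums v)
  moreover have "c / (2 * of_real x) * (((of_real x)\<^sup>2 - 1) * (pochhammer (of_nat k + 1) 2 * v ^ k)
        + 2 * (pochhammer (of_nat k + 1) 1 * v ^ k)) = extremal_coeff x k * z ^ k" for k
  proof -
    have vk: "v ^ k = of_real ((- x) ^ k) * z ^ k"
      unfolding v_def by (simp add: power_mult_distrib[symmetric])
    show ?thesis
      unfolding extremal_coeff_def c_def vk
      by (simp add: numeral_2_eq_2 pochhammer_Suc) (simp add: algebra_simps)
  qed
  moreover have "c / (2 * of_real x) * (((of_real x)\<^sup>2 - 1) * (fact 2 / (1 - v) ^ Suc 2)
        + 2 * (fact 1 / (1 - v) ^ Suc 1)) = extremal_deriv x z"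
  proof -
    have "(a - 1) * (fact 2 / u ^ Suc 2) + 2 * (fact 1 / u ^ Suc 1) = 2 * (a - (1 - u)) / u ^ 3"
      if "u \<noteq> 0" for a u :: complex
      using that by (simp add: eval_nat_numeral field_simps)
    from this[OF nz, of "(of_real x)\<^sup>2"]
    have "((of_real x)\<^sup>2 - 1) * (fact 2 / (1 - v) ^ Suc 2) + 2 * (fact 1 / (1 - v) ^ Suc 1)
       = 2 * ((of_real x)\<^sup>2 - v) / (1 - v) ^ 3"
      by simp
    also have "(of_real x)\<^sup>2 - v = of_real x * (z + of_real x)"
      by (simp add: v_def power2_eq_square algebra_simps)
    finally show ?thesis
      using assms(1) unfolding extremal_deriv_def c_def[symmetric] by (simp add: v_def)
  qed
  ultimately show ?thesis by simp
qed

text \<open>The summand is a quartic polynomial in \<open>k\<close> times \<open>t ^ k\<close>;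
  expanding the polynomial in rising factorials reduces the sum to negative binomial series.\<close>

lemma extremal_coeff_norm_sq_sums:
  fixes x r :: real
  assumes x: "x \<noteq> 0" and xr: "\<bar>x * r\<bar> < 1"
  shows "(\<lambda>k. (norm (extremal_coeff x k))\<^sup>2 * r ^ (2 * k)) sums
    (27 / 4 * (1 - x\<^sup>2)\<^sup>2 * ((r\<^sup>2 + x\<^sup>2) * (1 - r\<^sup>2 * x\<^sup>2)\<^sup>2 - 6 * r\<^sup>2 * x\<^sup>2 * (1 - x\<^sup>2) * (1 - r\<^sup>2))
      / (1 - r\<^sup>2 * x\<^sup>2) ^ 5)"
proof -
  define X y t q c where "X = x\<^sup>2" and "y = r\<^sup>2" and "t = X * y" and "q = X - 1"
    and "c = 27 / 4 * (1 - X)\<^sup>2 / (4 * X)"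
  have X: "X \<noteq> 0" using x by (simp add: X_def)
  have "(x * r)\<^sup>2 < 1" using xr by (simp add: abs_square_less_1)
  then have t: "norm t < 1" "1 - t \<noteq> 0"
    by (auto simp: t_def X_def y_def power_mult_distrib abs_mult)
  \<comment> \<open>The numerical coefficients are the coordinates of ((k + 1) ((k + 2) X - k))^2 in
    the rising factorials, using (k + 2) X - k = q (k + 2) + 2.\<close>
  have "(\<lambda>k. c * (-4 * (pochhammer (of_nat k + 1) 1 * t ^ k)
        + (4 - 8 * q + 2 * q\<^sup>2) * (pochhammer (of_nat k + 1) 2 * t ^ k)
        + (4 * q - 4 * q\<^sup>2) * (pochhammer (of_nat k + 1) 3 * t ^ k)
        + q\<^sup>2 * (pochhammer (of_nat k + 1) 4 * t ^ k)))
     sums (c * (-4 * (fact 1 / (1 - t) ^ Suc 1)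
        + (4 - 8 * q + 2 * q\<^sup>2) * (fact 2 / (1 - t) ^ Suc 2)
        + (4 * q - 4 * q\<^sup>2) * (fact 3 / (1 - t) ^ Suc 3)
        + q\<^sup>2 * (fact 4 / (1 - t) ^ Suc 4)))"
    by (intro sums_mult sums_add negative_binomial_sums t)
  moreover have "c * (-4 * (pochhammer (of_nat k + 1) 1 * t ^ k)
        + (4 - 8 * q + 2 * q\<^sup>2) * (pochhammer (of_nat k + 1) 2 * t ^ k)
        + (4 * q - 4 * q\<^sup>2) * (pochhammer (of_nat k + 1) 3 * t ^ k)
        + q\<^sup>2 * (pochhammer (of_nat k + 1) 4 * t ^ k)) = (norm (extremal_coeff x k))\<^sup>2 * r ^ (2 * k)" for k
  proof -
    have poly: "-4 * pochhammer (n + 1) 1 + (4 - 8 * q + 2 * q\<^sup>2) * pochhammer (n + 1) 2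
        + (4 * q - 4 * q\<^sup>2) * pochhammer (n + 1) 3 + q\<^sup>2 * pochhammer (n + 1) 4
        = ((n + 1) * ((n + 2) * X - n))\<^sup>2" for n :: real
      unfolding q_def by (simp add: eval_nat_numeral pochhammer_Suc) algebra
    have "(norm (extremal_coeff x k))\<^sup>2 * r ^ (2 * k) =
        (3 * sqrt 3 / 2 * (1 - x\<^sup>2) / (2 * x))\<^sup>2 * (((- x) ^ k)\<^sup>2 * r ^ (2 * k)) *
          ((real k + 1) * ((real k + 2) * X - real k))\<^sup>2"
      unfolding extremal_coeff_def norm_of_real X_def by (simp only: power2_abs power_mult_distrib mult_ac)
    also have "(3 * sqrt 3 / 2 * (1 - x\<^sup>2) / (2 * x))\<^sup>2 = c"
      unfolding c_def X_def by (simp add: power_mult_distrib power_divide)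
    also have "((- x) ^ k)\<^sup>2 * r ^ (2 * k) = t ^ k"
      unfolding t_def X_def y_def by (simp add: power_mult_distrib power_mult[symmetric] mult.commute)
    finally show ?thesis
      unfolding poly[symmetric] by (simp add: algebra_simps)
  qed
  moreover have "c * (-4 * (fact 1 / (1 - t) ^ Suc 1)
        + (4 - 8 * q + 2 * q\<^sup>2) * (fact 2 / (1 - t) ^ Suc 2)
        + (4 * q - 4 * q\<^sup>2) * (fact 3 / (1 - t) ^ Suc 3)
        + q\<^sup>2 * (fact 4 / (1 - t) ^ Suc 4)) =
     27 / 4 * (1 - X)\<^sup>2 * ((y + X) * (1 - y * X)\<^sup>2 - 6 * y * X * (1 - X) * (1 - y)) / (1 - y * X) ^ 5"
  proof -
    have "-4 * (fact 1 / (1 - t) ^ Suc 1)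
        + (4 - 8 * q + 2 * q\<^sup>2) * (fact 2 / (1 - t) ^ Suc 2)
        + (4 * q - 4 * q\<^sup>2) * (fact 3 / (1 - t) ^ Suc 3)
        + q\<^sup>2 * (fact 4 / (1 - t) ^ Suc 4) =
        (-4 * (1 - t) ^ 3 + 2 * (4 - 8 * q + 2 * q\<^sup>2) * (1 - t)\<^sup>2 + 6 * (4 * q - 4 * q\<^sup>2) * (1 - t) + 24 * q\<^sup>2)
          / (1 - t) ^ 5"
      (is "?L = _")
    proof -
      have e: "u / (1 - t) ^ i = u * (1 - t) ^ (5 - i) / (1 - t) ^ 5" if "i \<le> 5" for u i
      proof -
        have "(1 - t) ^ 5 = (1 - t) ^ (5 - i) * (1 - t) ^ i"
          using that by (simp flip: power_add)
        then show ?thesis using t(2) by simp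
      qed
      show ?thesis
        by (subst e, simp, subst (2) e, simp, subst (3) e, simp)
           (simp add: fact_numeral add_divide_distrib diff_divide_distrib algebra_simps)
    qed
    also have "-4 * (1 - t) ^ 3 + 2 * (4 - 8 * q + 2 * q\<^sup>2) * (1 - t)\<^sup>2 + 6 * (4 * q - 4 * q\<^sup>2) * (1 - t) + 24 * q\<^sup>2
       = 4 * X * ((y + X) * (1 - y * X)\<^sup>2 - 6 * y * X * (1 - X) * (1 - y))"
      unfolding q_def t_def by algebra
    finally show ?thesis
      using X unfolding c_def t_def by (simp add: mult.commute[of X y])
  qed
  ultimately show ?thesis unfolding X_def y_def by simp
qed

section \<open>Subordination of Bloch derivatives\<close>

text \<open>The invariance identity for 1 - |T w|^2 with T w = (w - x) / (1 - x w), cleared of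
  denominators.\<close>

lemma norm_moebius_diff:
  fixes x :: real and w :: complex
  shows "(norm (1 - of_real x * w))\<^sup>2 - (norm (w - of_real x))\<^sup>2 = (1 - x\<^sup>2) * (1 - (norm w)\<^sup>2)"
  unfolding cmod_power2 by (simp add: power2_eq_square) algebra

text \<open>Passing to the coordinate \<open>w = (z + x) / (1 + x z)\<close>, the Bloch bound becomes a uniform bound
  on the disc of radius \<open>1 / sqrt 3\<close>; after rescaling, \<open>f\<close> becomes a self-map \<open>K\<close> of the unit
  disc fixing \<open>sqrt 3 * x\<close>, and the extremal function becomes the identity.\<close>

lemma bloch_deriv_normal_condition:
  fixes f :: "complex \<Rightarrow> complex" and x :: real
  assumes x: "0 < x" "x < 1 / sqrt 3"
    and f: "f holomorphic_on ball 0 1" "\<And>z. norm z < 1 \<Longrightarrow> norm (f z) \<le> 1 / (1 - (norm z)\<^sup>2)"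
    and f0: "f 0 = of_real (3 * sqrt 3 / 2 * x * (1 - x\<^sup>2))"
    and z: "norm z < 1" "sqrt 3 * norm (z + of_real x) < norm (1 + of_real x * z)"
  shows "Re ((f z - extremal_deriv x z) * cnj (z * extremal_deriv2 x z)) \<le> 0"
proof -
  define S where "S = complex_of_real (sqrt 3)"
  define X where "X = complex_of_real x"
  have SS: "S * S = 3" unfolding S_def by (simp flip: of_real_mult)
  have S0: "S \<noteq> 0" by (simp add: S_def)
  have x1: "x < 1" using x(2) by (rule order_less_trans) simp
  have x2: "x\<^sup>2 < 1" using x x1 by (simp add: abs_square_less_1)
  have X2: "1 - X\<^sup>2 \<noteq> 0"
  proof -
    have "1 - X\<^sup>2 = of_real (1 - x\<^sup>2)" by (simp add: X_def)
    then show ?thesis using x2 by (simp del: of_real_diff of_real_power)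
  qed
  have nz: "1 - X * w \<noteq> 0" if "norm w < 1" for w
  proof -
    have "norm (X * w) < 1"
      using norm_mult_less[of X 1 w 1] that x x1 by (simp add: X_def)
    then show ?thesis by auto
  qed
  \<comment> \<open>This is 2 / 3 times \<open>f\<close> composed with the Moebius map, multiplied
    by the derivative of that map, on the disc of radius 1 / sqrt 3 rescaled to the unit disc. The
    Bloch bound is invariant under this change of variable and is at most 3 / 2 on the smaller disc,
    hence the factor 2 / 3.\<close>
  define K where "K u = 2 / 3 * (1 - X\<^sup>2) * f (Moebius_function 0 X (u / S)) / (1 - X * (u / S))\<^sup>2" for u
  have w: "norm (u / S) < 1" "(norm (u / S))\<^sup>2 \<le> 1 / 3" if "norm u < 1" for u
  proof -
    have "norm (u / S) = norm u / sqrt 3" by (simp add: S_def norm_divide)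
    moreover from this have "(norm (u / S))\<^sup>2 \<le> 1 / 3"
      using that by (simp add: power_divide power_le_one)
    moreover have "norm u / sqrt 3 < 1"
      using that real_less_rsqrt[of 1 3] by (simp add: order_less_trans[of _ 1])
    ultimately show "norm (u / S) < 1" "(norm (u / S))\<^sup>2 \<le> 1 / 3" by simp_all
  qed
  have Xn: "norm X < 1" using x x1 by (simp add: X_def)
  have holK: "K holomorphic_on ball 0 1"
  proof -
    have 1: "(\<lambda>u. u / S) holomorphic_on ball 0 1" by (intro holomorphic_intros S0)
    have 2: "(\<lambda>u. u / S) ` ball 0 1 \<subseteq> ball 0 1" using w(1) by auto
    have 3: "(\<lambda>u. Moebius_function 0 X (u / S)) holomorphic_on ball 0 1"
      using holomorphic_on_compose_gen[OF 1 Moebius_function_holomorphic[OF Xn] 2] by (simp add: o_def)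
    have 4: "(\<lambda>u. Moebius_function 0 X (u / S)) ` ball 0 1 \<subseteq> ball 0 1"
      using Moebius_function_norm_lt_1[OF Xn w(1)] by auto
    have 5: "(\<lambda>u. f (Moebius_function 0 X (u / S))) holomorphic_on ball 0 1"
      using holomorphic_on_compose_gen[OF 3 f(1) 4] by (simp add: o_def)
    show ?thesis
      unfolding K_def using nz[OF w(1)] S0 by (intro holomorphic_intros 5) auto
  qed
  have K1: "norm (K u) \<le> 1" if u: "norm u < 1" for u
  proof -
    define v where "v = u / S"
    define Z where "Z = Moebius_function 0 X v"
    have v: "norm v < 1" "(norm v)\<^sup>2 \<le> 1 / 3" using w[OF u] by (auto simp: v_def)
    have "norm Z < 1" unfolding Z_def by (rule Moebius_function_norm_lt_1[OF Xn v(1)])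
    then have fz: "norm (f Z) \<le> 1 / (1 - (norm Z)\<^sup>2)" by (rule f(2))
    define n where "n = (norm (1 - X * v))\<^sup>2"
    have n: "n > 0" using nz[OF v(1)] by (simp add: n_def)
    have "(norm Z)\<^sup>2 = (norm (v - X))\<^sup>2 / n"
      unfolding Z_def Moebius_function_simple n_def by (simp add: X_def norm_divide power_divide)
    then have "1 - (norm Z)\<^sup>2 = (1 - x\<^sup>2) * (1 - (norm v)\<^sup>2) / n"
      using norm_moebius_diff[of x v] n by (simp add: n_def X_def field_simps)
    then have "norm (f Z) \<le> n / ((1 - x\<^sup>2) * (1 - (norm v)\<^sup>2))"
      using fz by simp
    moreover have "norm (K u) = 2 / 3 * (1 - x\<^sup>2) * norm (f Z) / n"
    proof -
      have "norm (1 - X\<^sup>2) = 1 - x\<^sup>2"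
      proof -
        have "1 - X\<^sup>2 = of_real (1 - x\<^sup>2)" by (simp add: X_def)
        then show ?thesis using x2 by (simp only: norm_of_real)
      qed
      then show ?thesis
        unfolding K_def n_def Z_def v_def by (simp only: norm_mult norm_divide norm_power norm_numeral)
    qed
    ultimately have "norm (K u) \<le> 2 / 3 * (1 - x\<^sup>2) * (n / ((1 - x\<^sup>2) * (1 - (norm v)\<^sup>2))) / n"
      using x2 n by (simp only:) (intro divide_right_mono mult_left_mono, auto)
    also have "\<dots> = 2 / 3 / (1 - (norm v)\<^sup>2)"
    proof -
      have "2 / 3 * c * (n / (c * m)) / n = 2 / 3 / m" if "c \<noteq> 0" for c m :: real
        using that n by simp
      then show ?thesis using x2 by (metis diff_gt_0_iff_gt less_irrefl)
    qed
    also have "\<dots> \<le> 1" using v(2) by (simp add: field_simps)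
    finally show ?thesis .
  qed
  have p: "\<bar>sqrt 3 * x\<bar> < 1" using x by (simp add: field_simps abs_mult)
  have P: "of_real (sqrt 3 * x) = S * X" by (simp add: S_def X_def)
  \<comment> \<open>The Moebius map sends \<open>X\<close> to 0, and the prescribed value of
    \<open>f 0\<close> is exactly what makes \<open>S * X\<close> a fixed point.\<close>
  have Kp: "K (S * X) = S * X"
  proof -
    have "K (S * X) = 2 / 3 * (1 - X\<^sup>2) * f 0 / (1 - X\<^sup>2)\<^sup>2"
      using S0 by (simp add: K_def Moebius_function_eq_zero power2_eq_square)
    also have "f 0 = 3 / 2 * S * X * (1 - X\<^sup>2)"
      unfolding f0 by (simp add: S_def X_def)
    finally show ?thesis using X2 by (simp add: power2_eq_square[of "1 - X\<^sup>2"])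
  qed
  define d where "d = 1 + X * z"
  have d0: "d \<noteq> 0"
    using nz[of "-z"] z(1) by (simp add: d_def)
  define u where "u = S * ((z + X) / d)"
  have u1: "norm u < 1"
  proof -
    have "norm u = sqrt 3 * norm (z + of_real x) / norm d"
      by (simp add: u_def norm_mult norm_divide S_def X_def)
    then show ?thesis using z(2) d0 by (simp add: d_def X_def)
  qed
  have dd: "1 - X * ((z + X) / d) = (1 - X\<^sup>2) / d"
    using d0 by (simp add: field_simps d_def power2_eq_square)
  have Zu: "Moebius_function 0 X (u / S) = z"
  proof -
    have "(z + X) / d - X = z * (1 - X\<^sup>2) / d"
      using d0 by (simp add: field_simps d_def power2_eq_square)
    moreover have "Moebius_function 0 X (u / S) = ((z + X) / d - X) / (1 - X * ((z + X) / d))"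
      using S0 by (simp add: Moebius_function_simple u_def X_def)
    ultimately show ?thesis using dd d0 X2 by simp
  qed
  have Ku: "K u = 2 / 3 * f z * d\<^sup>2 / (1 - X\<^sup>2)"
  proof -
    have "K u = 2 / 3 * (1 - X\<^sup>2) * f z / ((1 - X\<^sup>2) / d)\<^sup>2"
      using dd Zu S0 by (simp add: K_def) (simp add: u_def)
    moreover have "2 / 3 * c * g / (c / d)\<^sup>2 = 2 / 3 * g * d\<^sup>2 / c" if "c \<noteq> 0" for c g
      using that d0 by (simp add: field_simps power2_eq_square)
    ultimately show ?thesis using X2 by metis
  qed
  have "Re ((K u - u) * cnj ((u - S * X) * (1 - S * X * u))) \<le> 0"
    using schwarz_pick_fixed_point_halfplane[OF holK K1 p _ u1] Kp by (simp only: P)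
  define W where "W = (K u - u) * cnj ((u - S * X) * (1 - S * X * u))"
  define c where "c = 9 / 4 * (1 - x\<^sup>2) / (norm d) ^ 4"
  have "Re W \<le> 0"
    unfolding W_def by fact
  \<comment> \<open>In the coordinate \<open>u\<close> the extremal function is the identity, so the
    difference is a multiple of \<open>K u - u\<close>. In \<open>e2\<close> the normal becomes a
    multiple of the Schwarz-Pick normal; both multiples have the phase of 1 / d^2, so the product
    with the conjugate leaves the nonnegative factor \<open>c\<close>.\<close>
  have e1: "f z - extremal_deriv x z = 3 / 2 * (1 - X\<^sup>2) / d\<^sup>2 * (K u - u)"
  proof -
    have ext: "extremal_deriv x z = 3 / 2 * S * (1 - X\<^sup>2) * ((z + X) / d ^ 3)"
      unfolding extremal_deriv_def S_def X_def d_def by simp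
    have gen: "g - 3 / 2 * S * c * (v / d ^ 3) = 3 / 2 * c / d\<^sup>2 * (2 / 3 * g * d\<^sup>2 / c - S * (v / d))"
      if "c \<noteq> 0" for c g v
      using that d0 by (simp add: field_simps power2_eq_square power3_eq_cube)
    show ?thesis
      unfolding Ku ext unfolding u_def by (rule gen[OF X2])
  qed
  have e2: "z * extremal_deriv2 x z = 3 / 2 / d\<^sup>2 * ((u - S * X) * (1 - S * X * u))"
  proof -
    have ext: "extremal_deriv2 x z = 3 / 2 * S * (1 - X\<^sup>2) * ((1 - 3 * X\<^sup>2 - 2 * X * z) / d ^ 4)"
      unfolding extremal_deriv2_def S_def X_def d_def by simp
    have u1': "u - S * X = S * z * (1 - X\<^sup>2) / d"
      unfolding u_def using d0 by (simp add: field_simps d_def power2_eq_square)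
    have "1 - S * X * u = 1 - (S * S) * X * ((z + X) / d)" by (simp add: u_def)
    then have u2': "1 - S * X * u = (1 - 3 * X\<^sup>2 - 2 * X * z) / d"
      unfolding SS using d0 by (simp add: field_simps d_def power2_eq_square)
    have gen: "z * (3 / 2 * S * c * (m / d ^ 4)) = 3 / 2 / d\<^sup>2 * (S * z * c / d * (m / d))" for c m
      by (simp add: eval_nat_numeral mult_ac)
    show ?thesis unfolding ext u1' u2' by (rule gen)
  qed
  have gen: "3 / 2 * m / d\<^sup>2 * p * cnj (3 / 2 / d\<^sup>2 * q) = 9 / 4 * m / (d * cnj d)\<^sup>2 * (p * cnj q)" for m p q
    by (simp add: power_mult_distrib)
  have "(f z - extremal_deriv x z) * cnj (z * extremal_deriv2 x z) =
      9 / 4 * (1 - X\<^sup>2) / (d * cnj d)\<^sup>2 * W"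
    unfolding e1 e2 W_def by (rule gen)
  also have "\<dots> = of_real c * W"
    unfolding complex_norm_square[symmetric] c_def X_def by simp
  finally have "Re ((f z - extremal_deriv x z) * cnj (z * extremal_deriv2 x z)) = c * Re W"
    by simp
  moreover have "c \<ge> 0" using x2 by (simp add: c_def)
  ultimately show ?thesis using \<open>Re W \<le> 0\<close> by (simp add: mult_nonneg_nonpos)
qed

text \<open>After squaring, the two sides depend on the argument of \<open>z\<close> only through a
  term 4 x Re z, so the positive real point of the circle is the worst case.\<close>

lemma bloch_disc_condition:
  fixes x :: real and z :: complex
  assumes "0 \<le> x" "sqrt 3 * (norm z + x) < 1 + x * norm z"
  shows "sqrt 3 * norm (z + of_real x) < norm (1 + of_real x * z)"
proof (rule power_less_imp_less_base)
  have "(sqrt 3 * (norm z + x))\<^sup>2 < (1 + x * norm z)\<^sup>2"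
    using assms by (intro power_strict_mono) auto
  then have "3 * (norm z + x)\<^sup>2 < (1 + x * norm z)\<^sup>2"
    by (simp add: power_mult_distrib)
  moreover have "4 * x * Re z \<le> 4 * x * norm z"
    using assms complex_Re_le_cmod[of z] by (intro mult_left_mono) auto
  moreover have "(norm (1 + of_real x * z))\<^sup>2 = 1 + 2 * x * Re z + x\<^sup>2 * (norm z)\<^sup>2"
    unfolding cmod_power2 by (simp add: power2_eq_square algebra_simps)
  moreover have "(norm (z + of_real x))\<^sup>2 = (norm z)\<^sup>2 + 2 * x * Re z + x\<^sup>2"
    unfolding cmod_power2 by (simp add: power2_eq_square algebra_simps)
  ultimately show "(sqrt 3 * norm (z + of_real x))\<^sup>2 < (norm (1 + of_real x * z))\<^sup>2"
    by (simp add: power_mult_distrib power2_sum algebra_simps)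
qed simp

text \<open>The numerator is (1 + x z) - 3 x (z + x), and the second term is smaller in modulus than
  the first because \<open>sqrt 3 * x < 1\<close>.\<close>

lemma extremal_deriv2_ne_0:
  assumes x: "0 < x" "x < 1 / sqrt 3"
    and z: "sqrt 3 * norm (z + of_real x) < norm (1 + of_real x * z)"
  shows "extremal_deriv2 x z \<noteq> 0"
proof -
  have "1 / sqrt 3 < (1::real)" by simp
  then have x1: "x < 1" using x by linarith
  then have x2: "x\<^sup>2 < 1" using x by (simp add: abs_square_less_1)
  have d: "1 + of_real x * z \<noteq> 0" using z norm_ge_zero[of "z + of_real x"]
    by (metis mult_nonneg_nonneg norm_zero not_less real_sqrt_ge_zero zero_le_numeral)
  have "norm (3 * of_real x * (z + of_real x)) = (sqrt 3 * x) * (sqrt 3 * norm (z + of_real x))"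
    using x by (simp add: norm_mult)
  also have "\<dots> \<le> 1 * (sqrt 3 * norm (z + of_real x))"
    using x by (intro mult_right_mono) (auto simp: field_simps)
  also have "\<dots> < norm (1 + of_real x * z)" using z by simp
  finally have "1 + of_real x * z \<noteq> 3 * of_real x * (z + of_real x)" by auto
  then have "1 - 3 * (of_real x)\<^sup>2 - 2 * of_real x * z \<noteq> 0"
    by (auto simp: algebra_simps power2_eq_square)
  moreover have "3 * sqrt 3 / 2 * (1 - x\<^sup>2) \<noteq> 0" using x2 by simp
  ultimately show ?thesis
    unfolding extremal_deriv2_def using d by (simp only: mult_eq_0_iff of_real_eq_0_iff divide_eq_0_iff) simp
qed

text \<open>In the coordinate \<open>w = (z + x) / (1 + x z)\<close> the extremal function is a multiple of
  \<open>w (1 - x w)\<^sup>2\<close>.\<close>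

lemma extremal_deriv_inj:
  assumes x: "0 < x" "x < 1 / sqrt 3"
    and z1: "sqrt 3 * norm (z1 + of_real x) < norm (1 + of_real x * z1)"
    and z2: "sqrt 3 * norm (z2 + of_real x) < norm (1 + of_real x * z2)"
    and eq: "extremal_deriv x z1 = extremal_deriv x z2"
  shows "z1 = z2"
proof -
  define X where "X = complex_of_real x"
  have "1 / sqrt 3 < (1::real)" by simp
  then have x1: "x < 1" using x by linarith
  then have x2: "x\<^sup>2 < 1" using x by (simp add: abs_square_less_1)
  have X2: "1 - X\<^sup>2 \<noteq> 0"
  proof -
    have "1 - X\<^sup>2 = of_real (1 - x\<^sup>2)" by (simp add: X_def)
    then show ?thesis using x2 by (simp del: of_real_diff of_real_power)
  qed
  define w where "w z = (z + X) / (1 + X * z)" for z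
  have nz: "1 + X * z \<noteq> 0" if "sqrt 3 * norm (z + of_real x) < norm (1 + of_real x * z)" for z
    using that norm_ge_zero[of "z + of_real x"] unfolding X_def
    by (metis mult_nonneg_nonneg norm_zero not_less real_sqrt_ge_zero zero_le_numeral)
  have s: "norm (X * w z) < 1 / 3" if "sqrt 3 * norm (z + of_real x) < norm (1 + of_real x * z)" for z
  proof -
    have "sqrt 3 * norm (w z) < 1"
      using that nz[OF that] by (simp add: w_def norm_divide X_def field_simps)
    moreover have "sqrt 3 * x < 1" using x by (simp add: field_simps)
    ultimately have "(sqrt 3 * x) * (sqrt 3 * norm (w z)) < 1 * 1"
      using x by (intro mult_strict_mono) auto
    moreover have "(sqrt 3 * x) * (sqrt 3 * norm (w z)) = 3 * norm (X * w z)"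
      using x by (simp add: norm_mult X_def)
    ultimately show ?thesis by simp
  qed
  have wz: "1 - X * w z = (1 - X\<^sup>2) / (1 + X * z)" if "1 + X * z \<noteq> 0" for z
    using that by (simp add: w_def field_simps power2_eq_square)
  have "(z + X) / (1 + X * z) ^ 3 = w z * (1 - X * w z)\<^sup>2 / (1 - X\<^sup>2)\<^sup>2" if "1 + X * z \<noteq> 0" for z
    unfolding wz[OF that] using that X2 by (simp add: w_def power2_eq_square power3_eq_cube)
  moreover have "(z1 + X) / (1 + X * z1) ^ 3 = (z2 + X) / (1 + X * z2) ^ 3"
  proof -
    have "3 * sqrt 3 / 2 * (1 - x\<^sup>2) \<noteq> 0" using x2 by simp
    then show ?thesis
      using eq unfolding extremal_deriv_def X_def by (simp only: mult_left_cancel of_real_eq_0_iff simp_thms)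
  qed
  ultimately have "w z1 * (1 - X * w z1)\<^sup>2 = w z2 * (1 - X * w z2)\<^sup>2"
    using nz[OF z1] nz[OF z2] X2 by simp
  then have "(w z1 - w z2) * ((1 - X * w z1 - X * w z2)\<^sup>2 - X * w z1 * (X * w z2)) = 0"
    by algebra
  \<comment> \<open>Both \<open>X * w z1\<close> and \<open>X * w z2\<close> have modulus below 1 /
    3, so the square has modulus above 1 / 9 while the product has modulus at most 1 / 9.\<close>
  moreover have "(1 - X * w z1 - X * w z2)\<^sup>2 - X * w z1 * (X * w z2) \<noteq> 0"
  proof -
    have "norm (X * w z1 + X * w z2) < 2 / 3"
      using norm_triangle_ineq[of "X * w z1" "X * w z2"] s[OF z1] s[OF z2] by linarith
    then have "1 / 3 < norm (1 - (X * w z1 + X * w z2))"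
      using norm_triangle_ineq2[of 1 "X * w z1 + X * w z2"] by simp
    then have "(1 / 3)\<^sup>2 < (norm (1 - X * w z1 - X * w z2))\<^sup>2"
      by (intro power_strict_mono) (auto simp: algebra_simps)
    moreover have "norm (X * w z1 * (X * w z2)) \<le> 1 / 3 * (1 / 3)"
      unfolding norm_mult[of "X * w z1"] using s[OF z1] s[OF z2] by (intro mult_mono) auto
    ultimately have "norm (X * w z1 * (X * w z2)) < norm ((1 - X * w z1 - X * w z2)\<^sup>2)"
      unfolding norm_power by (simp add: power_one_over power2_eq_square)
    then show ?thesis by auto
  qed
  ultimately have weq: "w z1 = w z2" by simp
  then have "(1 - X\<^sup>2) / (1 + X * z1) = (1 - X\<^sup>2) / (1 + X * z2)"
    by (metis nz wz z1 z2)
  then have "X * z1 = X * z2"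
    using X2 nz[OF z1] nz[OF z2] by (simp add: field_simps)
  then show ?thesis using x by (simp add: X_def)
qed

text \<open>The second condition on \<open>\<rho>\<close> keeps the disc of radius
  \<open>\<rho>\<close> inside the region where the normal condition, injectivity and a nonzero
  derivative are all available.\<close>

lemma bloch_deriv_subordinate:
  fixes f :: "complex \<Rightarrow> complex" and x \<rho> :: real
  assumes x: "0 < x" "x < 1 / sqrt 3"
    and f: "f holomorphic_on ball 0 1" "\<And>z. norm z < 1 \<Longrightarrow> norm (f z) \<le> 1 / (1 - (norm z)\<^sup>2)"
    and f0: "f 0 = of_real (3 * sqrt 3 / 2 * x * (1 - x\<^sup>2))"
    and \<rho>: "\<rho> < 1" "sqrt 3 * (\<rho> + x) \<le> 1 + x * \<rho>"
  obtains \<omega> where "\<omega> holomorphic_on ball 0 \<rho>" "\<And>z. norm z < \<rho> \<Longrightarrow> norm (\<omega> z) \<le> norm z"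
    "\<And>z. norm z < \<rho> \<Longrightarrow> f z = extremal_deriv x (\<omega> z)"
proof -
  have "1 / sqrt 3 < (1::real)" by simp
  then have x1: "x < 1" using x by linarith
  have xs: "x < sqrt 3" using x1 order_less_trans[of x 1 "sqrt 3"] by simp
  have disc: "sqrt 3 * norm (z + of_real x) < norm (1 + of_real x * z)" if "norm z < \<rho>" for z :: complex
  proof -
    have "(sqrt 3 - x) * norm z < (sqrt 3 - x) * \<rho>"
      using that xs by (intro mult_strict_left_mono) auto
    then have "sqrt 3 * (norm z + x) < 1 + x * norm z"
      using \<rho>(2) by (simp add: algebra_simps)
    then show ?thesis using x by (intro bloch_disc_condition) auto
  qed
  have nz: "1 + of_real x * z \<noteq> 0" if "norm z < \<rho>" for z :: complex
    using disc[OF that] norm_ge_zero[of "z + of_real x"]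
    by (metis mult_nonneg_nonneg norm_zero not_less real_sqrt_ge_zero zero_le_numeral)
  have deriv: "(extremal_deriv x has_field_derivative extremal_deriv2 x z) (at z)" if "norm z < \<rho>" for z
    using nz[OF that] by (rule extremal_deriv_has_field_derivative)
  \<comment> \<open>A rotation carries \<open>\<zeta>\<close> to \<open>z\<close>. The rotated
    function satisfies the same hypotheses, so the single value \<open>f z\<close> is tested against
    the normals at all points of its circle.\<close>
  have normal: "Re ((f z - extremal_deriv x \<zeta>) * cnj (\<zeta> * extremal_deriv2 x \<zeta>)) \<le> 0"
    if z: "norm z < \<rho>" "z \<noteq> 0" "norm \<zeta> = norm z" for z \<zeta>
  proof -
    define e where "e = z / \<zeta>"
    have e: "norm e = 1" using z by (simp add: e_def norm_divide)
    have "(\<lambda>v. f (e * v)) holomorphic_on ball 0 1"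
    proof -
      have "(\<lambda>v. e * v) holomorphic_on ball 0 1" by (intro holomorphic_intros)
      moreover have "(\<lambda>v. e * v) ` ball 0 1 \<subseteq> ball 0 1" using e by (auto simp: norm_mult)
      ultimately show ?thesis
        using holomorphic_on_compose_gen[OF _ f(1)] by (force simp: o_def)
    qed
    moreover have "norm (f (e * v)) \<le> 1 / (1 - (norm v)\<^sup>2)" if "norm v < 1" for v
      using f(2)[of "e * v"] e that by (simp add: norm_mult)
    moreover have "norm \<zeta> < \<rho>" using z by simp
    ultimately have "Re ((f (e * \<zeta>) - extremal_deriv x \<zeta>) * cnj (\<zeta> * extremal_deriv2 x \<zeta>)) \<le> 0"
      using f0 \<rho>(1) disc[of \<zeta>] by (intro bloch_deriv_normal_condition[where f = "\<lambda>v. f (e * v)"] x) auto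
    moreover have "e * \<zeta> = z" using z by (auto simp: e_def)
    ultimately show ?thesis by simp
  qed
  have mem: "f z \<in> extremal_deriv x ` cball 0 (norm z)" if z: "norm z < \<rho>" for z
  proof (cases "z = 0")
    case True
    have "f 0 = extremal_deriv x 0" unfolding f0 extremal_deriv_def by simp
    then show ?thesis using True by simp
  next
    case False
    show ?thesis
    proof (rule mem_image_cball_of_normal_condition[where G' = "extremal_deriv2 x"])
      fix v :: complex assume "norm v \<le> norm z"
      then have "norm v < \<rho>" using z by simp
      then show "(extremal_deriv x has_field_derivative extremal_deriv2 x v) (at v)"
        "extremal_deriv2 x v \<noteq> 0"
        using deriv extremal_deriv2_ne_0[OF x disc] by auto
    qed (use False z normal in auto)
  qed
  have hol: "extremal_deriv x holomorphic_on ball 0 \<rho>"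
    using deriv field_differentiable_at_within field_differentiable_def
    unfolding holomorphic_on_def by (metis mem_ball_0)
  have inj: "inj_on (extremal_deriv x) (ball 0 \<rho>)"
    using extremal_deriv_inj[OF x disc disc] by (intro inj_onI) auto
  have "f holomorphic_on ball 0 \<rho>"
    using f(1) \<rho>(1) by (auto intro: holomorphic_on_subset)
  from subordination_of_mem_image_cball[OF this hol inj mem] that show ?thesis by blast
qed

text \<open>Bessel bounds the partial sums by the mean square of \<open>f\<close>, and Rogosinski
  bounds that by the coefficient sum of the extremal function. Radius 0 is included because the
  bound is later integrated from 0.\<close>

lemma bloch_deriv_coeff_sum_bound:
  fixes f :: "complex \<Rightarrow> complex" and x \<rho> :: real
  assumes x: "0 < x" "x < 1 / sqrt 3"
    and f: "f holomorphic_on ball 0 1" "\<And>z. norm z < 1 \<Longrightarrow> norm (f z) \<le> 1 / (1 - (norm z)\<^sup>2)"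
    and f0: "f 0 = of_real (3 * sqrt 3 / 2 * x * (1 - x\<^sup>2))"
    and \<rho>: "\<rho> < 1" "sqrt 3 * (\<rho> + x) \<le> 1 + x * \<rho>"
    and r: "0 \<le> r" "r \<le> \<rho>" "0 < \<rho>"
    and a: "\<And>z. norm z < 1 \<Longrightarrow> (\<lambda>k. a k * z ^ k) sums f z"
  shows "(\<Sum>k<N. (norm (a k))\<^sup>2 * r ^ (2 * k)) \<le>
    27 / 4 * (1 - x\<^sup>2)\<^sup>2 * ((r\<^sup>2 + x\<^sup>2) * (1 - r\<^sup>2 * x\<^sup>2)\<^sup>2 - 6 * r\<^sup>2 * x\<^sup>2 * (1 - x\<^sup>2) * (1 - r\<^sup>2))
      / (1 - r\<^sup>2 * x\<^sup>2) ^ 5"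
    (is "?L r \<le> ?R r")
proof -
  have "1 / sqrt 3 < (1::real)" by simp
  then have x1: "x < 1" using x by linarith
  obtain \<omega> where om: "\<omega> holomorphic_on ball 0 \<rho>" "\<And>z. norm z < \<rho> \<Longrightarrow> norm (\<omega> z) \<le> norm z"
    "\<And>z. norm z < \<rho> \<Longrightarrow> f z = extremal_deriv x (\<omega> z)"
    using bloch_deriv_subordinate[OF x f f0 \<rho>] by blast
  have xz: "norm (of_real x * z) < 1" if "norm z < \<rho>" for z :: complex
    using norm_mult_less[of "of_real x" 1 z 1] x x1 that \<rho> by simp
  have sums: "(\<lambda>k. extremal_coeff x k * z ^ k) sums extremal_deriv x z" if "norm z < \<rho>" for z
    using x xz[OF that] by (intro extremal_coeff_sums) auto
  have open_bound: "?L s \<le> ?R s" if s: "0 < s" "s < \<rho>" for s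
  proof -
    have "\<bar>x * s\<bar> < 1" using xz[of "of_real s"] s by (simp add: norm_mult abs_mult)
    have "?L s \<le> circle_mean_sq s f"
      using s \<rho>(1) by (intro bessel_circle_mean_sq[OF a]) auto
    also have "\<dots> \<le> ?R s"
    proof (rule rogosinski_circle_mean_sq[OF _ _ om(1,2) s])
      show "(\<lambda>k. extremal_coeff x k * \<omega> z ^ k) sums f z" if "norm z < \<rho>" for z
        using sums[of "\<omega> z"] om(2,3)[OF that] that by simp
      show "\<forall>w::complex. norm w < \<rho> \<longrightarrow> summable (\<lambda>k. extremal_coeff x k * w ^ k)"
        using sums sums_summable by blast
      show "(\<lambda>k. (norm (extremal_coeff x k))\<^sup>2 * s ^ (2 * k)) sums ?R s"
        using x \<open>\<bar>x * s\<bar> < 1\<close> by (intro extremal_coeff_norm_sq_sums) auto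
    qed
    finally show ?thesis .
  qed
  have nz: "1 - s\<^sup>2 * x\<^sup>2 \<noteq> 0" if "0 \<le> s" "s \<le> \<rho>" for s
  proof -
    have "s * x < 1 * 1"
      using that x x1 \<rho> by (intro mult_strict_mono) auto
    then have "(s * x)\<^sup>2 < 1" using that x by (simp add: abs_square_less_1)
    then show ?thesis by (simp add: power_mult_distrib)
  qed
  \<comment> \<open>Subordination lives on the open disc, so the endpoints 0 and
    \<open>\<rho>\<close> are reached by continuity; the left side is a polynomial since only
    partial sums occur.\<close>
  define D where "D s = ?R s - ?L s" for s
  have "continuous_on {0..\<rho>} D"
    unfolding D_def using nz by (intro continuous_intros) auto
  moreover have "0 \<le> D s" if "s \<in> {0<..<\<rho>}" for s
    unfolding D_def using open_bound[of s] that by (simp only: diff_ge_0_iff_ge greaterThanLessThan_iff)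
  moreover have "closure {0<..<\<rho>} = {0..\<rho>}"
    using r(3) by (rule closure_greaterThanLessThan)
  ultimately have "0 \<le> D r"
    using r(1,2) continuous_ge_on_closure[of "{0<..<\<rho>}" D r 0] by simp
  then show ?thesis unfolding D_def by (simp only: diff_ge_0_iff_ge)
qed

section \<open>Integration in the squared radius and the two estimates\<close>

text \<open>With \<open>X\<close> and \<open>y\<close> in the roles of x^2 and r^2, and up to
  constant factors, the second bound is an antiderivative of the first bound divided by r^2.\<close>

lemma area_bound_has_derivative:
  fixes X y :: real
  assumes "1 - X * y \<noteq> 0"
  shows "((\<lambda>y. y * (3 * X * (1 - y)\<^sup>2 + (1 - X * y) * (y - X)) / (1 - X * y) ^ 4) has_real_derivative
    2 * ((y + X) * (1 - y * X)\<^sup>2 - 6 * y * X * (1 - X) * (1 - y)) / (1 - y * X) ^ 5) (at y)"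
proof -
  define u where "u = 1 - X * y"
  define P where "P = (\<lambda>y. y * (3 * X * (1 - y)\<^sup>2 + (1 - X * y) * (y - X)))"
  define P' where "P' = 3 * X * (1 - y)\<^sup>2 + (1 - X * y) * (y - X)
     + y * (- 6 * X * (1 - y) - X * (y - X) + (1 - X * y))"
  have "(P has_real_derivative P') (at y)"
    unfolding P_def P'_def by (auto intro!: derivative_eq_intros simp: algebra_simps power2_eq_square)
  moreover have "((\<lambda>y. (1 - X * y) ^ 4) has_real_derivative (- 4 * X * u ^ 3)) (at y)"
    unfolding u_def by (auto intro!: derivative_eq_intros)
  ultimately have "((\<lambda>y. P y / (1 - X * y) ^ 4) has_real_derivative
      (P' * u ^ 4 - P y * (- 4 * X * u ^ 3)) / (u ^ 4 * u ^ 4)) (at y)"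
    using assms unfolding u_def by (intro DERIV_divide) auto
  moreover have "(P' * u ^ 4 - P y * (- 4 * X * u ^ 3)) / (u ^ 4 * u ^ 4) = (P' * u + 4 * X * P y) / u ^ 5"
    using assms unfolding u_def[symmetric] by (simp add: field_simps eval_nat_numeral)
  moreover have "P' * u + 4 * X * P y = 2 * ((y + X) * (1 - y * X)\<^sup>2 - 6 * y * X * (1 - X) * (1 - y))"
    unfolding P'_def P_def u_def by algebra
  ultimately show ?thesis unfolding P_def u_def by (simp add: mult.commute)
qed

text \<open>\<open>G\<close> minus the termwise antiderivative vanishes at 0 and has nonnegative
  derivative, so the inequality is integrated by monotonicity alone.\<close>

lemma power_series_sum_bound_integrate:
  fixes c :: "nat \<Rightarrow> real" and g G :: "real \<Rightarrow> real"
  assumes "0 \<le> b" "G 0 = 0"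
    and G: "\<And>y. 0 \<le> y \<Longrightarrow> y \<le> b \<Longrightarrow> (G has_real_derivative g y) (at y)"
    and le: "\<And>y. 0 \<le> y \<Longrightarrow> y \<le> b \<Longrightarrow> (\<Sum>k<N. (real k + 1) * c k * y ^ k) \<le> g y"
  shows "(\<Sum>k<N. c k * b ^ Suc k) \<le> G b"
proof -
  have "((\<lambda>y. G y - (\<Sum>k<N. c k * y ^ Suc k)) has_real_derivative
      g y - (\<Sum>k<N. (real k + 1) * c k * y ^ k)) (at y)" if "0 \<le> y" "y \<le> b" for y
  proof (rule DERIV_diff[OF G[OF that]], rule DERIV_sum)
    show "((\<lambda>y. c k * y ^ Suc k) has_real_derivative (real k + 1) * c k * y ^ k) (at y)" for k
      using DERIV_cmult[OF DERIV_pow[of "Suc k" y], of "c k"]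
      by (simp add: mult_ac add.commute del: power_Suc)
  qed
  then have "G 0 - (\<Sum>k<N. c k * 0 ^ Suc k) \<le> G b - (\<Sum>k<N. c k * b ^ Suc k)"
    using le by (intro DERIV_nonneg_imp_nondecreasing[OF \<open>0 \<le> b\<close>]) force
  then show ?thesis using \<open>G 0 = 0\<close> by simp
qed

theorem theorem1:
  fixes F :: "complex \<Rightarrow> complex" and x r a :: real
  assumes hF: "F \<in> bloch_class"
    and hx: "0 < x" "x < 1 / sqrt 3"
    and ha: "a = 3 * sqrt 3 / 2 * x * (1 - x\<^sup>2)"
    and ha01: "0 < a" "a < 1"
    and hb1: "taylor_coeff F 1 = complex_of_real a"
    and hr: "0 < r" "r \<le> (sqrt (1/3) - x) / (1 - x * sqrt (1/3))"
  shows "(\<Sum>k. real (Suc k)^2 * (norm (taylor_coeff F (Suc k)))\<^sup>2 * r ^ (2 * Suc k))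
          \<le> 27 * r\<^sup>2 * (1 - x\<^sup>2)\<^sup>2 * ((r\<^sup>2 + x\<^sup>2) * (1 - r\<^sup>2 * x\<^sup>2)\<^sup>2
               - 6 * r\<^sup>2 * x\<^sup>2 * (1 - x\<^sup>2) * (1 - r\<^sup>2)) / (4 * (1 - r\<^sup>2 * x\<^sup>2) ^ 5)
    \<and> (\<Sum>k. real (Suc k) * (norm (taylor_coeff F (Suc k)))\<^sup>2 * r ^ (2 * Suc k))
          \<le> 27 * r\<^sup>2 * (1 - x\<^sup>2)\<^sup>2 * (3 * x\<^sup>2 * (1 - r\<^sup>2)\<^sup>2 + (1 - x\<^sup>2 * r\<^sup>2) * (r\<^sup>2 - x\<^sup>2))
               / (8 * (1 - r\<^sup>2 * x\<^sup>2) ^ 4)"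
proof -
  define b where "b k = norm (taylor_coeff F (Suc k))" for k
  define X where "X = x\<^sup>2"
  have "1 / sqrt 3 < (1::real)" by simp
  then have x1: "x < 1" using hx by linarith
  have pos: "0 < sqrt 3 - x"
    using x1 order_less_trans[of x 1 "sqrt 3"] by simp
  have "(sqrt (1/3) - x) / (1 - x * sqrt (1/3)) = (sqrt 3 * (sqrt (1/3) - x)) / (sqrt 3 * (1 - x * sqrt (1/3)))"
    by simp
  also have "\<dots> = (1 - sqrt 3 * x) / (sqrt 3 - x)"
    by (simp add: real_sqrt_divide algebra_simps)
  finally have rho: "r \<le> (1 - sqrt 3 * x) / (sqrt 3 - x)" using hr(2) by simp
  then have "r * (sqrt 3 - x) \<le> 1 - sqrt 3 * x"
    using pos by (simp add: pos_le_divide_eq)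
  then have r_disc: "sqrt 3 * (r + x) \<le> 1 + x * r"
    by (simp add: algebra_simps)
  have r1: "r < 1"
  proof (rule ccontr)
    assume "\<not> r < 1"
    then have "(sqrt 3 - x) * 1 \<le> (sqrt 3 - x) * r" using pos by (intro mult_left_mono) auto
    then have "sqrt 3 - x \<le> 1 - sqrt 3 * x" using r_disc by (simp add: algebra_simps)
    then have "(sqrt 3 - 1) * (1 + x) \<le> 0" by (simp add: algebra_simps)
    moreover have "0 < (sqrt 3 - 1) * (1 + x)"
      using hx by (intro mult_pos_pos) auto
    ultimately show False by simp
  qed
  have hol: "F holomorphic_on ball 0 1"
    and bd: "\<And>z. norm z < 1 \<Longrightarrow> norm (deriv F z) \<le> 1 / (1 - (norm z)\<^sup>2)"
    using hF by (auto simp: bloch_class_def)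
  have hol': "deriv F holomorphic_on ball 0 1"
    using hol by (intro holomorphic_deriv) auto
  have f0: "deriv F 0 = of_real (3 * sqrt 3 / 2 * x * (1 - x\<^sup>2))"
    using hb1 unfolding ha taylor_coeff_def by simp
  have coeff: "(\<lambda>k. of_nat (Suc k) * taylor_coeff F (Suc k) * z ^ k) sums deriv F z" if "norm z < 1" for z
  proof -
    have "(\<lambda>k. (deriv ^^ k) (deriv F) 0 / fact k * (z - 0) ^ k) sums deriv F z"
      using hol' that by (intro holomorphic_power_series[where r = 1]) auto
    moreover have "(deriv ^^ k) (deriv F) 0 / fact k = of_nat (Suc k) * taylor_coeff F (Suc k)" for k
    proof -
      have "complex_of_nat (fact (Suc k)) = of_nat (Suc k) * fact k"
        by (simp add: algebra_simps)
      then show ?thesis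
        unfolding taylor_coeff_def funpow_Suc_right o_apply by (simp del: of_nat_Suc fact_Suc)
    qed
    ultimately show ?thesis by simp
  qed
  \<comment> \<open>Here \<open>y\<close> is a squared radius ranging over the whole interval, as
    the integration requires. One factor \<open>real k + 1\<close> is kept apart because integrating
    the power of \<open>y\<close> absorbs it.\<close>
  have bound: "(\<Sum>k<N. (real k + 1) * ((real k + 1) * (b k)\<^sup>2) * y ^ k) \<le>
    27 / 4 * (1 - X)\<^sup>2 * ((y + X) * (1 - y * X)\<^sup>2 - 6 * y * X * (1 - X) * (1 - y)) / (1 - y * X) ^ 5"
    if y: "0 \<le> y" "y \<le> r\<^sup>2" for y N
  proof -
    have "sqrt y \<le> r" using y hr(1) by (intro real_le_lsqrt) auto
    have "(real k + 1) * ((real k + 1) * (b k)\<^sup>2) * y ^ k =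
        (norm (of_nat (Suc k) * taylor_coeff F (Suc k)))\<^sup>2 * sqrt y ^ (2 * k)" for k
      using y by (simp add: b_def norm_mult power_mult power_mult_distrib power2_eq_square del: of_nat_Suc)
        (simp add: add.commute)
    moreover have "(sqrt y)\<^sup>2 = y" using y by simp
    ultimately show ?thesis
      using bloch_deriv_coeff_sum_bound[OF hx hol' bd f0 r1 r_disc _ \<open>sqrt y \<le> r\<close> hr(1) coeff, of N] y
      by (simp add: X_def)
  qed
  have nz: "1 - X * y \<noteq> 0" if "0 \<le> y" "y \<le> r\<^sup>2" for y
  proof -
    have "X < 1" using hx x1 by (simp add: X_def abs_square_less_1)
    moreover have "y < 1" using that r1 hr(1) abs_square_less_1[of r] by simp
    ultimately have "X * y < 1 * 1"
      using that by (intro mult_strict_mono) (auto simp: X_def)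
    then show ?thesis by simp
  qed
  have part1: "(\<Sum>k<N. real (Suc k)^2 * (b k)\<^sup>2 * r ^ (2 * Suc k)) \<le>
      27 * r\<^sup>2 * (1 - x\<^sup>2)\<^sup>2 * ((r\<^sup>2 + x\<^sup>2) * (1 - r\<^sup>2 * x\<^sup>2)\<^sup>2
               - 6 * r\<^sup>2 * x\<^sup>2 * (1 - x\<^sup>2) * (1 - r\<^sup>2)) / (4 * (1 - r\<^sup>2 * x\<^sup>2) ^ 5)" for N
  proof -
    have "(\<Sum>k<N. real (Suc k)^2 * (b k)\<^sup>2 * r ^ (2 * Suc k)) =
        r\<^sup>2 * (\<Sum>k<N. (real k + 1) * ((real k + 1) * (b k)\<^sup>2) * (r\<^sup>2) ^ k)"
      unfolding sum_distrib_left
    proof (rule sum.cong[OF refl])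
      fix k
      have sq: "real (Suc k)^2 = (real k + 1) * (real k + 1)"
        unfolding power2_eq_square of_nat_Suc by (simp only: add.commute)
      have "r ^ (2 * Suc k) = r\<^sup>2 * (r\<^sup>2) ^ k" by (simp add: power_mult del: mult_Suc_right)
      then show "real (Suc k)^2 * (b k)\<^sup>2 * r ^ (2 * Suc k) =
          r\<^sup>2 * ((real k + 1) * ((real k + 1) * (b k)\<^sup>2) * (r\<^sup>2) ^ k)"
        by (simp only: sq mult_ac)
    qed
    also have "\<dots> \<le> r\<^sup>2 * (27 / 4 * (1 - X)\<^sup>2 * ((r\<^sup>2 + X) * (1 - r\<^sup>2 * X)\<^sup>2
        - 6 * r\<^sup>2 * X * (1 - X) * (1 - r\<^sup>2)) / (1 - r\<^sup>2 * X) ^ 5)"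
      by (intro mult_left_mono bound) auto
    finally show ?thesis by (simp add: X_def mult_ac)
  qed
  have part2: "(\<Sum>k<N. real (Suc k) * (b k)\<^sup>2 * r ^ (2 * Suc k)) \<le>
      27 * r\<^sup>2 * (1 - x\<^sup>2)\<^sup>2 * (3 * x\<^sup>2 * (1 - r\<^sup>2)\<^sup>2 + (1 - x\<^sup>2 * r\<^sup>2) * (r\<^sup>2 - x\<^sup>2))
               / (8 * (1 - r\<^sup>2 * x\<^sup>2) ^ 4)" for N
  proof -
    define G where "G y = 27 / 8 * (1 - X)\<^sup>2 *
      (y * (3 * X * (1 - y)\<^sup>2 + (1 - X * y) * (y - X)) / (1 - X * y) ^ 4)" for y
    have dG: "(G has_real_derivative 27 / 4 * (1 - X)\<^sup>2 *
        ((y + X) * (1 - y * X)\<^sup>2 - 6 * y * X * (1 - X) * (1 - y)) / (1 - y * X) ^ 5) (at y)"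
      if "0 \<le> y" "y \<le> r\<^sup>2" for y
    proof -
      have "(G has_real_derivative 27 / 8 * (1 - X)\<^sup>2 *
        (2 * ((y + X) * (1 - y * X)\<^sup>2 - 6 * y * X * (1 - X) * (1 - y)) / (1 - y * X) ^ 5)) (at y)"
        unfolding G_def by (intro DERIV_cmult area_bound_has_derivative nz that)
      moreover have "27 / 8 * q * (2 * n / m) = 27 / 4 * q * n / m" for q n m :: real
        by simp
      ultimately show ?thesis by (simp only:)
    qed
    have "(\<Sum>k<N. real (Suc k) * (b k)\<^sup>2 * r ^ (2 * Suc k)) =
        (\<Sum>k<N. (real k + 1) * (b k)\<^sup>2 * (r\<^sup>2) ^ Suc k)"
      by (simp add: power_mult[symmetric] add.commute del: power_Suc)
    also have "\<dots> \<le> G (r\<^sup>2)"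
      by (rule power_series_sum_bound_integrate[OF _ _ dG bound]) (auto simp: G_def)
    also have "\<dots> = 27 * r\<^sup>2 * (1 - x\<^sup>2)\<^sup>2 * (3 * x\<^sup>2 * (1 - r\<^sup>2)\<^sup>2 + (1 - x\<^sup>2 * r\<^sup>2) * (r\<^sup>2 - x\<^sup>2))
               / (8 * (1 - r\<^sup>2 * x\<^sup>2) ^ 4)"
      by (simp add: G_def X_def mult_ac)
    finally show ?thesis .
  qed
  \<comment> \<open>Bounded partial sums of nonnegative terms give summability, so
    \<open>suminf\<close> is the true sum here and not a default value.\<close>
  have suminf_le: "suminf h \<le> B" if "\<And>k. 0 \<le> h k" "\<And>N. sum h {..<N} \<le> B" for h :: "nat \<Rightarrow> real" and B
    using that by (intro suminf_le_const summableI_nonneg_bounded) auto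
  show ?thesis
    unfolding b_def[symmetric] using hr(1)
    by (intro conjI suminf_le part1 part2) auto
qed

end
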